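(* Let $m\in\mathbb{Z}$ and let $\mathbb{L}_m$ be the simplest cubic field generated over $\mathbb{Q}$ by a root of the polynomial $l_m(x)=x^3-mx^2-(m+3)x-1$. Then $$I(\mathbb{L}_m)=1$$ and $$i(\mathbb{L}_m)=\begin{cases}3&\text{if } m\equiv 39,120,201\pmod{243},\\ 1&\text{otherwise.}\end{cases}$$
   Context: For a number field $\mathbb{K}$ of degree $n$ over $\mathbb{Q}$ with ring of integers $\mathbb{A}$, let $\widehat{\mathbb{A}}$ be the set of $\theta\in\mathbb{A}$ that are primitive over $\mathbb{Q}$, i.e. $\mathbb{K}=\mathbb{Q}(\theta)$. For $\theta\in\widehat{\mathbb{A}}$ let $I(\theta)=[\mathbb{A}:\mathbb{Z}[\theta]]$ and define $I(\mathbb{K})=\gcd_{\theta\in\widehat{\mathbb{A}}} I(\theta)$. For $\theta\in\mathbb{A}$ let $F_\theta(x)\in\mathbb{Z}[x]$ be the (degree $n$) characteristic polynomial of $\theta$ over $\mathbb{Q}$ and set $i(\theta)=\gcd_{x\in\mathbb{Z}}F_\theta(x)$. Define $i(\mathbb{K})=\operatorname{lcm}_{\theta\in\widehat{\mathbb{A}}}\, i(\theta)$. *)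

theory Defs
  imports
    "HOL-Algebra.Algebraic_Closure_Type"
    "HOL-Algebra.Generated_Fields"
    "HOL-Number_Theory.Cong"
    "Jordan_Normal_Form.Char_Poly"
begin

text \<open>
  Number fields are represented as subfields of the complex numbers, that is, as sets
  \<open>K :: complex set\<close>. The definitions below are meaningful when \<open>K\<close> is a number field.
\<close>

abbreviation rat_scale :: "rat \<Rightarrow> complex \<Rightarrow> complex" where
  "rat_scale q z \<equiv> of_rat q * z"

interpretation rat_vs: vector_space rat_scale
  by unfold_locales (simp_all add: algebra_simps of_rat_add of_rat_mult)

definition rat_adjoin :: "complex \<Rightarrow> complex set" where
  "rat_adjoin \<theta> = generate_field ring_of_type_algebra {\<theta>}"

definition int_adjoin :: "complex \<Rightarrow> complex set" where
  "int_adjoin \<theta> = range (\<lambda>p :: int poly. poly (map_poly of_int p) \<theta>)"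

definition ring_of_integers :: "complex set \<Rightarrow> complex set" where
  "ring_of_integers K = {x \<in> K. algebraic_int x}"

definition primitive_integers :: "complex set \<Rightarrow> complex set" where
  "primitive_integers K = {\<theta> \<in> ring_of_integers K. K = rat_adjoin \<theta>}"

text \<open>
  The index of the additive group of \<open>int_adjoin \<theta>\<close> in that of the ring of integers. It is
  finite for every primitive integer, so the convention that \<^const>\<open>card\<close> is \<open>0\<close> on
  infinite sets plays no role in \<open>index_gcd\<close>.
\<close>

definition element_index :: "complex set \<Rightarrow> complex \<Rightarrow> nat" where
  "element_index K \<theta> =
     card (a_rcosets\<^bsub>ring_of_type_algebra\<lparr>carrier := ring_of_integers K\<rparr>\<^esub> (int_adjoin \<theta>))"

definition index_gcd :: "complex set \<Rightarrow> nat" where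
  "index_gcd K = Gcd (element_index K ` primitive_integers K)"

definition is_rat_basis :: "complex set \<Rightarrow> complex list \<Rightarrow> bool" where
  "is_rat_basis K bs \<longleftrightarrow>
     distinct bs \<and> rat_vs.independent (set bs) \<and> rat_vs.span (set bs) = K"

text \<open>
  The matrix of \<open>x \<mapsto> \<theta> * x\<close>: column \<open>j\<close> holds the coordinates of \<open>\<theta> * bs ! j\<close>.
\<close>

definition mult_matrix :: "complex list \<Rightarrow> complex \<Rightarrow> rat mat" where
  "mult_matrix bs \<theta> = mat (length bs) (length bs)
     (\<lambda>(i, j). rat_vs.representation (set bs) (\<theta> * bs ! j) (bs ! i))"

text \<open>The characteristic polynomial does not depend on the basis chosen here.\<close>

definition rat_char_poly :: "complex set \<Rightarrow> complex \<Rightarrow> rat poly" where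
  "rat_char_poly K \<theta> = char_poly (mult_matrix (SOME bs. is_rat_basis K bs) \<theta>)"

text \<open>
  For \<open>\<theta>\<close> in the ring of integers of \<open>K\<close>, \<open>rat_char_poly K \<theta>\<close> has integer coefficients;
  \<open>int_char_poly K \<theta>\<close> is the same polynomial, as an element of \<^typ>\<open>int poly\<close>.
\<close>

definition int_char_poly :: "complex set \<Rightarrow> complex \<Rightarrow> int poly" where
  "int_char_poly K \<theta> = (THE F. map_poly of_int F = rat_char_poly K \<theta>)"

definition value_gcd :: "complex set \<Rightarrow> complex \<Rightarrow> int" where
  "value_gcd K \<theta> = Gcd (range (\<lambda>x :: int. poly (int_char_poly K \<theta>) x))"

text \<open>
  For integers, \<^const>\<open>Lcm\<close> of a set with infinitely many absolute values is \<open>0\<close>, so a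
  nonzero value of \<open>value_lcm\<close> includes the finiteness of the set of values.
\<close>

definition value_lcm :: "complex set \<Rightarrow> int" where
  "value_lcm K = Lcm (value_gcd K ` primitive_integers K)"

definition simplest_cubic :: "int \<Rightarrow> int poly" where
  "simplest_cubic m = [:- 1, - (m + 3), - m, 1:]"

end

theory Submission
  imports Defs "HOL-Algebra.Sylow"
begin

text \<open>
  The conjugates of a root \<open>\<alpha>\<close> of the simplest cubic are polynomials in \<open>\<alpha>\<close>, its discriminant
  \<open>(m\<^sup>2 + 3 * m + 9)\<^sup>2\<close> is odd, and its norm form is even only at even vectors (the prime 2 is
  inert).

  For the index, the ring of integers has a basis \<open>1, \<omega>, \<theta>\<close> with \<open>\<omega> * \<theta>\<close> an integer, and then
  the index of \<open>x * \<omega> + y * \<theta>\<close> is the value of a binary cubic form. An odd prime dividing all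
  values divides all four coefficients, which makes \<open>\<omega> / p\<close> integral; the prime 2 does not divide
  the index of \<open>\<alpha>\<close>.

  The third difference of a monic cubic is 6, so every \<open>i(\<theta>)\<close> divides 6, and it is odd because 2 is
  inert. If 3 divides \<open>i(\<theta>)\<close>, then \<open>F\<^sub>\<theta>\<close> is congruent to \<open>x ^ 3 - x\<close> mod 3: its discriminant is prime to
  3, so \<open>\<alpha>\<close> lies in \<open>\<int>[\<theta>]\<close> up to a denominator prime to 3, and by Hensel lifting \<open>F\<^sub>\<theta>\<close>, hence also
  the simplest cubic, has a root mod 81. This forces \<open>m\<close> to be 39 mod 81, which is the stated
  condition mod 243. Conversely, for such \<open>m\<close> the element \<open>(\<alpha> - 1) / 3\<close> is an integer with
  \<open>i = 3\<close>.
\<close>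

section \<open>Algebraic integers are closed under the ring operations\<close>

text \<open>The list \<open>vs\<close>, read as a vector, is an eigenvector of the transpose of
  \<open>M\<close>, which has the same characteristic polynomial. This serves twice: with integer
  matrices for integrality, and with \<open>mult_matrix\<close> for the characteristic polynomial of
  an element.\<close>

lemma char_poly_root_if_eigenvector:
  fixes M :: "complex mat" and vs :: "complex list"
  assumes M: "M \<in> carrier_mat (length vs) (length vs)"
    and nz: "v \<in> set vs" "v \<noteq> 0"
    and ev: "\<And>j. j < length vs \<Longrightarrow> x * vs ! j = (\<Sum>i<length vs. M $$ (i, j) * vs ! i)"
  shows "poly (char_poly M) x = 0"
proof -
  define n where "n = length vs"
  have MT: "transpose_mat M \<in> carrier_mat n n"
    using M by (simp add: n_def)
  have dim: "dim_row M = length vs" "dim_col M = length vs"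
    using carrier_matD[OF M] by simp_all
  have "eigenvector (transpose_mat M) (vec_of_list vs) x"
    unfolding eigenvector_def
  proof (intro conjI)
    show "vec_of_list vs \<in> carrier_vec (dim_row (transpose_mat M))"
      by (rule carrier_vecI) (simp add: dim)
    show "vec_of_list vs \<noteq> 0\<^sub>v (dim_row (transpose_mat M))"
    proof
      assume eq: "vec_of_list vs = 0\<^sub>v (dim_row (transpose_mat M))"
      from nz(1) obtain i where i: "i < length vs" "vs ! i = v"
        by (auto simp: in_set_conv_nth)
      have "vec_of_list vs $ i = 0"
        using eq i by (simp add: dim)
      with i nz(2) show False
        by (simp add: vec_of_list_index)
    qed
    show "transpose_mat M *\<^sub>v vec_of_list vs = x \<cdot>\<^sub>v vec_of_list vs"
    proof (rule eq_vecI)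
      fix j assume "j < dim_vec (x \<cdot>\<^sub>v vec_of_list vs)"
      then have j: "j < length vs" by simp
      have "(transpose_mat M *\<^sub>v vec_of_list vs) $ j = (\<Sum>i<length vs. M $$ (i, j) * vs ! i)"
        using j by (simp add: scalar_prod_def vec_of_list_index atLeast0LessThan dim mult.commute)
      with ev[OF j] j show "(transpose_mat M *\<^sub>v vec_of_list vs) $ j = (x \<cdot>\<^sub>v vec_of_list vs) $ j"
        by (simp add: vec_of_list_index)
    qed (simp add: dim)
  qed
  then have "eigenvalue (transpose_mat M) x"
    by (auto simp: eigenvalue_def)
  then have "poly (char_poly (transpose_mat M)) x = 0"
    using eigenvalue_root_char_poly[OF MT] by simp
  with M show ?thesis by simp
qed

interpretation int_mod: Modules.module "\<lambda>(k :: int) (z :: complex). of_int k * z"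
  by unfold_locales (simp_all add: algebra_simps)

text \<open>The determinant trick: x acts on a finitely generated \<int>-module by an integer
  matrix, whose characteristic polynomial is monic with integer coefficients and has the root
  x.\<close>

lemma algebraic_int_if_stable_span:
  assumes fin: "finite S" and "v \<in> S" "v \<noteq> 0"
    and st: "\<And>s. s \<in> S \<Longrightarrow> x * s \<in> int_mod.span S"
  shows "algebraic_int x"
proof -
  obtain vs where vs: "set vs = S" "distinct vs"
    using finite_distinct_list[OF fin] by blast
  define n where "n = length vs"
  have "\<exists>c. x * s = (\<Sum>t\<in>S. of_int (c t) * t)" if "s \<in> S" for s
    using st[OF that] by (auto simp: int_mod.span_finite[OF fin])
  then obtain c where c: "\<And>s. s \<in> S \<Longrightarrow> x * s = (\<Sum>t\<in>S. of_int (c s t) * t)"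
    by metis
  define M where "M = mat n n (\<lambda>(i, j). c (vs ! j) (vs ! i))"
  have M: "M \<in> carrier_mat n n"
    by (simp add: M_def)
  have "poly (char_poly (map_mat of_int M)) x = 0"
  proof (rule char_poly_root_if_eigenvector)
    show "map_mat of_int M \<in> carrier_mat (length vs) (length vs)"
      using M by (simp add: n_def)
    show "v \<in> set vs" "v \<noteq> 0" using assms vs by auto
    fix j assume j: "j < length vs"
    then have "x * vs ! j = (\<Sum>t\<in>set vs. of_int (c (vs ! j) t) * t)"
      using c[of "vs ! j"] vs by auto
    also have "\<dots> = (\<Sum>i<length vs. of_int (c (vs ! j) (vs ! i)) * vs ! i)"
      using sum.reindex_bij_betw[OF bij_betw_nth[OF vs(2) refl refl],
          of "\<lambda>t. of_int (c (vs ! j) t) * t"] by simp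
    finally show "x * vs ! j = (\<Sum>i<length vs. map_mat of_int M $$ (i, j) * vs ! i)"
      using j by (simp add: M_def n_def)
  qed
  then have "poly (map_poly of_int (char_poly M)) x = 0"
    by (simp only: of_int_hom.char_poly_hom[OF M])
  moreover have "lead_coeff (char_poly M) = 1"
    using degree_monic_char_poly[OF M] by simp
  ultimately show ?thesis
    by (auto simp: algebraic_int_altdef_ipoly)
qed

lemma int_mod_span_mult:
  assumes "\<And>s. s \<in> S \<Longrightarrow> x * s \<in> int_mod.span S" "z \<in> int_mod.span S"
  shows "x * z \<in> int_mod.span S"
  using assms(2)
proof (induction rule: int_mod.span_induct_alt)
  case base
  then show ?case by (simp add: int_mod.span_zero)
next
  case (step c s y)
  have "x * (of_int c * s + y) = of_int c * (x * s) + x * y"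
    by (simp add: algebra_simps)
  with step show ?case
    using assms(1) by (simp add: int_mod.span_add int_mod.span_scale)
qed

lemma algebraic_int_power_reduce:
  assumes p: "poly (map_poly of_int p) x = 0" "lead_coeff p = 1"
  shows "x ^ degree p = (\<Sum>i<degree p. of_int (- coeff p i) * (x :: complex) ^ i)"
proof -
  have "0 = (\<Sum>i\<le>degree p. of_int (coeff p i) * x ^ i)"
    using p(1) by (simp add: poly_altdef degree_map_poly coeff_map_poly)
  also have "{..degree p} = insert (degree p) {..<degree p}" by auto
  finally have "0 = x ^ degree p + (\<Sum>i<degree p. of_int (coeff p i) * x ^ i)"
    using p(2) by simp
  then show ?thesis
    by (simp add: sum_negf eq_neg_iff_add_eq_0)
qed

text \<open>The monomials below the degrees of two monic relations span \<int>[x, y], which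
  multiplication by x and by y preserves; hence so do x + y and x * y.\<close>

lemma algebraic_int_common_span:
  assumes "algebraic_int x" "algebraic_int y"
  obtains S :: "complex set" where "finite S" "1 \<in> S"
    "\<And>s. s \<in> S \<Longrightarrow> x * s \<in> int_mod.span S" "\<And>s. s \<in> S \<Longrightarrow> y * s \<in> int_mod.span S"
proof -
  obtain p where p: "poly (map_poly of_int p) x = 0" "lead_coeff p = 1"
    using assms(1) by (auto simp: algebraic_int_altdef_ipoly)
  obtain q where q: "poly (map_poly of_int q) y = 0" "lead_coeff q = 1"
    using assms(2) by (auto simp: algebraic_int_altdef_ipoly)
  have deg: "degree p > 0" "degree q > 0"
    using p q by (auto intro!: Nat.gr0I elim!: degree_eq_zeroE)
  define S where "S = (\<lambda>(i, j). x ^ i * y ^ j) ` ({..<degree p} \<times> {..<degree q})"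
  have mem: "x ^ i * y ^ j \<in> int_mod.span S" if "i < degree p" "j < degree q" for i j
    using that by (intro int_mod.span_base) (auto simp: S_def)
  show ?thesis
  proof (rule that)
    show "finite S" by (simp add: S_def)
    show "1 \<in> S" using deg by (auto simp: S_def intro!: image_eqI[of _ _ "(0, 0)"])
    fix s assume "s \<in> S"
    then obtain i j where ij: "i < degree p" "j < degree q" "s = x ^ i * y ^ j"
      by (auto simp: S_def)
    show "x * s \<in> int_mod.span S"
    \<comment> \<open>Only the top exponent leaves the box of monomials, and there the monic
      relation of x brings it back.\<close>
    proof (cases "Suc i = degree p")
      case True
      have "x * s = x ^ degree p * y ^ j" by (simp add: ij flip: True)
      also have "\<dots> = (\<Sum>i<degree p. of_int (- coeff p i) * (x ^ i * y ^ j))"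
        by (simp add: algebraic_int_power_reduce[OF p] sum_distrib_right mult.assoc)
      also have "\<dots> \<in> int_mod.span S"
        using ij by (intro int_mod.span_sum int_mod.span_scale mem) auto
      finally show ?thesis .
    next
      case False
      have "x * s = x ^ Suc i * y ^ j" by (simp add: ij)
      then show ?thesis using mem[of "Suc i" j] ij False by (simp add: mult_ac)
    qed
    show "y * s \<in> int_mod.span S"
    proof (cases "Suc j = degree q")
      case True
      have "y * s = x ^ i * y ^ degree q" by (simp add: ij flip: True)
      also have "\<dots> = (\<Sum>j<degree q. of_int (- coeff q j) * (x ^ i * y ^ j))"
        by (simp add: algebraic_int_power_reduce[OF q] sum_distrib_left mult_ac)
      also have "\<dots> \<in> int_mod.span S"
        using ij by (intro int_mod.span_sum int_mod.span_scale mem) auto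
      finally show ?thesis .
    next
      case False
      have "y * s = x ^ i * y ^ Suc j" by (simp add: ij)
      then show ?thesis using mem[of i "Suc j"] ij False by (simp add: mult_ac)
    qed
  qed
qed

lemma
  fixes x y :: complex
  assumes "algebraic_int x" "algebraic_int y"
  shows algebraic_int_add: "algebraic_int (x + y)"
    and algebraic_int_mult: "algebraic_int (x * y)"
proof -
  from assms obtain S :: "complex set" where S: "finite S" "1 \<in> S"
    "\<And>s. s \<in> S \<Longrightarrow> x * s \<in> int_mod.span S" "\<And>s. s \<in> S \<Longrightarrow> y * s \<in> int_mod.span S"
    using algebraic_int_common_span by blast
  show "algebraic_int (x + y)"
  proof (rule algebraic_int_if_stable_span[OF S(1,2)])
    show "(x + y) * s \<in> int_mod.span S" if "s \<in> S" for s
      unfolding distrib_right using S(3,4)[OF that] by (rule int_mod.span_add)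
  qed simp
  show "algebraic_int (x * y)"
  proof (rule algebraic_int_if_stable_span[OF S(1,2)])
    show "x * y * s \<in> int_mod.span S" if "s \<in> S" for s
      using int_mod_span_mult[OF S(3) S(4)[OF that]] by (simp only: mult.assoc)
  qed simp
qed

lemma algebraic_int_of_int [simp]: "algebraic_int (of_int k :: complex)"
  using int_imp_algebraic_int Ints_of_int by blast

lemma algebraic_int_diff:
  fixes x y :: complex
  assumes "algebraic_int x" "algebraic_int y"
  shows "algebraic_int (x - y)"
  using algebraic_int_add[OF assms(1), of "- y"] assms(2) by simp

lemma algebraic_int_pow:
  fixes x :: complex
  assumes "algebraic_int x"
  shows "algebraic_int (x ^ n)"
  by (induction n) (use assms algebraic_int_mult in \<open>auto intro: int_imp_algebraic_int\<close>)

lemmas algebraic_int_ring_intros =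
  algebraic_int_add algebraic_int_diff algebraic_int_mult algebraic_int_pow algebraic_int_of_int

section \<open>Prime divisors of the index of a subgroup\<close>

text \<open>If p divided the order of the quotient, Cauchy's theorem would give a nontrivial class
  killed by p. That class is also killed by N, which is prime to p.\<close>

lemma (in comm_group) prime_not_dvd_index:
  assumes H: "subgroup H G" and fin: "finite (rcosets H)" and p: "prime p"
    and N: "\<And>x. x \<in> carrier G \<Longrightarrow> x [^] (N :: nat) \<in> H" and pN: "\<not> p dvd N"
  shows "\<not> p dvd card (rcosets H)"
proof
  assume "p dvd card (rcosets H)"
  then obtain k where k: "card (rcosets H) = p * k" by blast
  interpret H: normal H G
    using H by (simp add: subgroup_imp_normal)
  define Q where "Q = G Mod H"
  interpret Q: group Q
    unfolding Q_def by (rule H.factorgroup_is_group)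
  have carr: "carrier Q = rcosets H"
    by (simp add: Q_def FactGroup_def)
  \<comment> \<open>Sylow's theorem with exponent 1 yields a subgroup of order p, and Lagrange's
    theorem then makes p annihilate each of its elements.\<close>
  obtain P where P: "subgroup P Q" "card P = p"
    using sylow_thm[OF p Q.is_group, of 1 k] fin k carr by (auto simp: Coset.order_def)
  interpret P: subgroup P Q by (rule P)
  have "card P > 1" using P p prime_gt_1_nat by simp
  then have "\<not> P \<subseteq> {\<one>\<^bsub>Q\<^esub>}"
    using card_mono[of "{\<one>\<^bsub>Q\<^esub>}" P] by auto
  then obtain Y where Y: "Y \<in> P" "Y \<noteq> \<one>\<^bsub>Q\<^esub>" by blast
  have XQ: "Y \<in> carrier Q" using Y P.subset by auto
  have fP: "finite P" using P p prime_gt_0_nat card_gt_0_iff by metis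
  interpret P': group "Q\<lparr>carrier := P\<rparr>"
    using P.subgroup_is_group[OF Q.is_group] .
  have "Y [^]\<^bsub>Q\<lparr>carrier := P\<rparr>\<^esub> p = \<one>\<^bsub>Q\<^esub>"
    using P'.pow_order_eq_1[of Y] Y P by (simp add: Coset.order_def)
  then have Xp: "Y [^]\<^bsub>Q\<^esub> p = \<one>\<^bsub>Q\<^esub>"
    by (subst Q.nat_pow_consistent[of _ _ P]) simp
  have "Y \<in> rcosets H" using XQ carr by simp
  then obtain x where x: "x \<in> carrier G" "Y = H #> x"
    unfolding RCOSETS_def by blast
  have "Y [^]\<^bsub>Q\<^esub> n = H #> (x [^] n)" for n :: nat
  proof (induction n)
    case 0
    then show ?case by (simp add: Q_def FactGroup_def H.subset)
  next
    case (Suc n)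
    have "Y [^]\<^bsub>Q\<^esub> Suc n = (H #> x [^] n) <#> (H #> x)"
      using Suc x(2) by (simp add: Q_def FactGroup_def)
    also have "\<dots> = H #> x [^] Suc n"
      using x(1) by (simp add: H.rcos_sum)
    finally show ?case .
  qed
  then have XN: "Y [^]\<^bsub>Q\<^esub> N = \<one>\<^bsub>Q\<^esub>"
    using N[OF x(1)] H by (simp add: Q_def FactGroup_def coset_join2 subgroup.subset)
  have "Q.ord Y dvd p" "Q.ord Y dvd N"
    using Xp XN Q.pow_eq_id[OF XQ] by auto
  moreover have "Rings.coprime p N"
    using prime_imp_coprime[OF p pN] .
  ultimately have "Q.ord Y = 1"
    using coprime_common_divisor_nat by blast
  with Y(2) XQ show False
    using Q.ord_eq_1 by simp
qed

section \<open>The field generated by one complex number\<close>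

lemma rat_adjoin_incl: "\<theta> \<in> rat_adjoin \<theta>"
  unfolding rat_adjoin_def by (rule generate_field.incl) simp

lemma rat_adjoin_add: "x \<in> rat_adjoin \<theta> \<Longrightarrow> y \<in> rat_adjoin \<theta> \<Longrightarrow> x + y \<in> rat_adjoin \<theta>"
  unfolding rat_adjoin_def
  using generate_field.eng_add[of x ring_of_type_algebra "{\<theta>}" y]
  by (simp add: ring_of_type_algebra_def)

lemma rat_adjoin_mult: "x \<in> rat_adjoin \<theta> \<Longrightarrow> y \<in> rat_adjoin \<theta> \<Longrightarrow> x * y \<in> rat_adjoin \<theta>"
  unfolding rat_adjoin_def
  using generate_field.eng_mult[of x ring_of_type_algebra "{\<theta>}" y]
  by (simp add: ring_of_type_algebra_def)

text \<open>\<open>generate_field\<close> is closed under the inverses of the record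
  \<open>ring_of_type_algebra\<close>; this lemma and the next turn them into the operations of the
  type class.\<close>

lemma a_inv_ring_of_type_algebra:
  "a_inv (ring_of_type_algebra :: 'a :: field ring) x = - x"
proof -
  interpret R: Ring.field "ring_of_type_algebra :: 'a ring" by (rule field_from_type_algebra)
  show ?thesis
    by (rule R.minus_equality) (simp_all add: ring_of_type_algebra_def)
qed

lemma m_inv_ring_of_type_algebra:
  assumes "x \<noteq> (0 :: 'a :: field)"
  shows "m_inv ring_of_type_algebra x = inverse x"
proof -
  interpret R: Ring.field "ring_of_type_algebra :: 'a ring" by (rule field_from_type_algebra)
  show ?thesis
    using assms by (intro R.comm_inv_char) (simp_all add: ring_of_type_algebra_def)
qed

lemma rat_adjoin_minus:
  assumes "x \<in> rat_adjoin \<theta>"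
  shows "- x \<in> rat_adjoin \<theta>"
  using generate_field.a_inv[of x ring_of_type_algebra "{\<theta>}"] assms
  by (simp add: rat_adjoin_def a_inv_ring_of_type_algebra)

lemma rat_adjoin_inverse:
  assumes "x \<in> rat_adjoin \<theta>"
  shows "inverse x \<in> rat_adjoin \<theta>"
proof (cases "x = 0")
  case False
  then show ?thesis
    using generate_field.m_inv[of x ring_of_type_algebra "{\<theta>}"] assms
    by (simp add: rat_adjoin_def m_inv_ring_of_type_algebra)
      (simp add: ring_of_type_algebra_def)
qed (use assms in simp)

lemma rat_adjoin_one: "1 \<in> rat_adjoin \<theta>"
  using generate_field.one[of ring_of_type_algebra "{\<theta>}"]
  by (simp add: rat_adjoin_def ring_of_type_algebra_def)

lemma rat_adjoin_of_int: "of_int k \<in> rat_adjoin \<theta>"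
proof (induction k rule: int_induct[where k = 0])
  case base
  show ?case using rat_adjoin_add[OF rat_adjoin_one rat_adjoin_minus[OF rat_adjoin_one]] by simp
next
  case (step1 i)
  then show ?case using rat_adjoin_add[OF _ rat_adjoin_one] by simp
next
  case (step2 i)
  then show ?case using rat_adjoin_add[OF _ rat_adjoin_minus[OF rat_adjoin_one]] by simp
qed

lemma rat_adjoin_Rats:
  assumes "q \<in> \<rat>"
  shows "q \<in> rat_adjoin \<theta>"
proof -
  obtain a b where "q = of_int a / of_int b"
    using assms by (auto elim: Rats_cases')
  then show ?thesis
    using rat_adjoin_mult[OF rat_adjoin_of_int rat_adjoin_inverse[OF rat_adjoin_of_int]]
    by (simp add: field_class.field_divide_inverse)
qed

lemma rat_adjoin_subset:
  assumes "\<theta> \<in> S" "1 \<in> S"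
    and "\<And>x y. x \<in> S \<Longrightarrow> y \<in> S \<Longrightarrow> x + y \<in> S" "\<And>x. x \<in> S \<Longrightarrow> - x \<in> S"
    and "\<And>x y. x \<in> S \<Longrightarrow> y \<in> S \<Longrightarrow> x * y \<in> S" "\<And>x. x \<in> S \<Longrightarrow> x \<noteq> 0 \<Longrightarrow> inverse x \<in> S"
  shows "rat_adjoin \<theta> \<subseteq> S"
proof
  fix x assume "x \<in> rat_adjoin \<theta>"
  then show "x \<in> S"
    unfolding rat_adjoin_def
  proof (induction rule: generate_field.induct)
    case (m_inv h)
    then have "h \<noteq> 0" by (simp add: ring_of_type_algebra_def)
    with m_inv show ?case using assms(6) by (simp add: m_inv_ring_of_type_algebra)
  next
    case (a_inv h)
    then show ?case using assms(4) by (simp only: a_inv_ring_of_type_algebra)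
  qed (use assms in \<open>simp_all add: ring_of_type_algebra_def\<close>)
qed

lemma rat_adjoin_least:
  assumes "x \<in> rat_adjoin \<theta>"
  shows "rat_adjoin x \<subseteq> rat_adjoin \<theta>"
  by (rule rat_adjoin_subset)
    (use assms in \<open>auto intro: rat_adjoin_one rat_adjoin_add rat_adjoin_minus rat_adjoin_mult rat_adjoin_inverse\<close>)

lemma rat_adjoin_Rats_subset:
  assumes "\<theta> \<in> \<rat>"
  shows "rat_adjoin \<theta> \<subseteq> \<rat>"
  by (rule rat_adjoin_subset) (use assms in auto)

section \<open>Denominators, discriminants and the norm form\<close>

lemma Rats_common_denominator:
  assumes "a \<in> \<rat>" "b \<in> \<rat>" "c \<in> (\<rat> :: complex set)"
  obtains d u v w :: int where "d > 0" "of_int d * a = of_int u" "of_int d * b = of_int v"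
    "of_int d * c = of_int w"
proof -
  obtain a1 a2 where a: "a2 > 0" "a = of_int a1 / of_int a2"
    using assms(1) by (auto elim: Rats_cases')
  obtain b1 b2 where b: "b2 > 0" "b = of_int b1 / of_int b2"
    using assms(2) by (auto elim: Rats_cases')
  obtain c1 c2 where c: "c2 > 0" "c = of_int c1 / of_int c2"
    using assms(3) by (auto elim: Rats_cases')
  show ?thesis
    by (rule that[of "a2 * b2 * c2" "a1 * b2 * c2" "b1 * a2 * c2" "c1 * a2 * b2"])
      (use a b c in simp_all)
qed

text \<open>Cramer's rule for the Vandermonde system in u, v, w. The determinant times a coefficient
  is an algebraic integer; one more factor gives the rational number \<open>d\<close>, so that the
  products are rational as well. It is used in both directions: for integers of the field over the
  powers of \<alpha>, and for \<alpha> over the powers of an integer.\<close>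

lemma disc_mult_coeffs_Ints:
  fixes b0 b1 b2 x0 x1 x2 :: complex
  defines "d \<equiv> ((b0 - b1) * (b1 - b2) * (b2 - b0)) ^ 2"
  assumes b: "algebraic_int b0" "algebraic_int b1" "algebraic_int b2"
    and x: "algebraic_int x0" "algebraic_int x1" "algebraic_int x2"
    and rat: "u \<in> \<rat>" "v \<in> \<rat>" "w \<in> \<rat>" and d: "d \<in> \<rat>"
    and eq: "x0 = u + v * b0 + w * b0\<^sup>2" "x1 = u + v * b1 + w * b1\<^sup>2" "x2 = u + v * b2 + w * b2\<^sup>2"
  shows "d * u \<in> \<int>" "d * v \<in> \<int>" "d * w \<in> \<int>"
proof -
  \<comment> \<open>The Vandermonde determinant of the rows 1, b, b^2; its square is
    \<open>d\<close>.\<close>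
  define e where "e = (b0 - b1) * (b1 - b2) * (b2 - b0)"
  have e: "algebraic_int e"
    unfolding e_def by (intro algebraic_int_ring_intros b)
  have "d * w = - e * (x0 * (b1 - b2) + x1 * (b2 - b0) + x2 * (b0 - b1))"
    unfolding d_def e_def eq by Groebner_Basis.algebra
  also have "algebraic_int \<dots>"
    by (intro algebraic_int_ring_intros algebraic_int_minus e b x)
  finally have dw: "algebraic_int (d * w)" .
  have "d * v = e * (x0 * (b1\<^sup>2 - b2\<^sup>2) + x1 * (b2\<^sup>2 - b0\<^sup>2) + x2 * (b0\<^sup>2 - b1\<^sup>2))"
    unfolding d_def e_def eq by Groebner_Basis.algebra
  also have "algebraic_int \<dots>"
    by (intro algebraic_int_ring_intros algebraic_int_minus e b x)
  finally have dv: "algebraic_int (d * v)" .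
  have "algebraic_int d"
    unfolding d_def e_def[symmetric] by (intro algebraic_int_ring_intros e)
  moreover have "d * u = d * x0 - d * v * b0 - d * w * b0\<^sup>2"
    unfolding eq by Groebner_Basis.algebra
  ultimately have du: "algebraic_int (d * u)"
    by (auto intro!: algebraic_int_ring_intros dv dw b x)
  show "d * u \<in> \<int>" "d * v \<in> \<int>" "d * w \<in> \<int>"
    using du dv dw rat d by (auto intro!: rational_algebraic_int_is_int)
qed

lemma disc_cubic:
  fixes a b c :: complex
  shows "((a - b) * (b - c) * (c - a))\<^sup>2 =
    (a + b + c)\<^sup>2 * (a * b + b * c + c * a)\<^sup>2 - 4 * (a * b + b * c + c * a) ^ 3
    - 4 * (a + b + c) ^ 3 * (a * b * c)
    + 18 * (a + b + c) * (a * b + b * c + c * a) * (a * b * c) - 27 * (a * b * c)\<^sup>2"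
  by (simp add: algebra_simps power2_eq_square power3_eq_cube)

text \<open>The norm of u + v \<alpha> + w \<alpha>^2, expanded in the coefficients of the simplest
  cubic. The type is general so that the form can be evaluated at rational complex numbers and at
  integers.\<close>

definition norm_form :: "'a :: comm_ring_1 \<Rightarrow> 'a \<Rightarrow> 'a \<Rightarrow> 'a \<Rightarrow> 'a" where
  "norm_form m u v w = u ^ 3 + m * u\<^sup>2 * v + (m\<^sup>2 + 2 * m + 6) * u\<^sup>2 * w - (m + 3) * u * v\<^sup>2
    - (m\<^sup>2 + 3 * m + 3) * u * v * w + (m\<^sup>2 + 4 * m + 9) * u * w\<^sup>2
    + v ^ 3 + m * v\<^sup>2 * w - (m + 3) * v * w\<^sup>2 + w ^ 3"

lemma norm_form_prod:
  fixes a0 a1 a2 :: complex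
  assumes "a0 + a1 + a2 = m" "a0 * a1 + a1 * a2 + a2 * a0 = - (m + 3)" "a0 * a1 * a2 = 1"
  shows "(u + v * a0 + w * a0\<^sup>2) * (u + v * a1 + w * a1\<^sup>2) * (u + v * a2 + w * a2\<^sup>2) = norm_form m u v w"
proof -
  define s1 s2 s3 where s: "s1 = a0 + a1 + a2" "s2 = a0 * a1 + a1 * a2 + a2 * a0" "s3 = a0 * a1 * a2"
  have "(u + v * a0 + w * a0\<^sup>2) * (u + v * a1 + w * a1\<^sup>2) * (u + v * a2 + w * a2\<^sup>2) =
    u ^ 3 + s1 * u\<^sup>2 * v + (s1\<^sup>2 - 2 * s2) * u\<^sup>2 * w + s2 * u * v\<^sup>2 + (s1 * s2 - 3 * s3) * u * v * w
    + (s2\<^sup>2 - 2 * s1 * s3) * u * w\<^sup>2 + s3 * v ^ 3 + s1 * s3 * v\<^sup>2 * w + s2 * s3 * v * w\<^sup>2 + s3\<^sup>2 * w ^ 3"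
    unfolding s by Groebner_Basis.algebra
  also have "\<dots> = norm_form m u v w"
    unfolding s assms norm_form_def by (simp add: algebra_simps power2_eq_square)
  finally show ?thesis .
qed

lemma norm_form_scale: "norm_form m (k * u) (k * v) (k * w) = k ^ 3 * norm_form m u v w"
  unfolding norm_form_def by (simp add: algebra_simps power2_eq_square power3_eq_cube)

lemma norm_form_of_int: "norm_form (of_int m) (of_int u) (of_int v) (of_int w) = of_int (norm_form m u v w)"
  by (simp add: norm_form_def)

text \<open>Modulo 2 the simplest cubic is x^3 + x + 1 or x^3 + x^2 + 1, depending on the parity of
  m. Both are irreducible, so the form reduces to the norm of the field with 8 elements, which
  vanishes only at 0.\<close>

lemma even_norm_form_iff:
  "even (norm_form m u v (w :: int)) \<longleftrightarrow> even u \<and> even v \<and> even w"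
  by (simp add: norm_form_def, blast?)

text \<open>Infinite descent by halving: a zero is even in all entries, and its half is again a zero
  because the form is homogeneous. Linear independence of 1, \<alpha>, \<alpha>^2, and with it the
  degree 3 of the field, rests on this.\<close>

lemma norm_form_eq_0_int:
  assumes "norm_form m u v (w :: int) = 0"
  shows "u = 0 \<and> v = 0 \<and> w = 0"
  using assms
proof (induction "nat (\<bar>u\<bar> + \<bar>v\<bar> + \<bar>w\<bar>)" arbitrary: u v w rule: less_induct)
  case less
  show ?case
  proof (rule ccontr)
    assume nz: "\<not> ?thesis"
    have "even u \<and> even v \<and> even w"
      using even_norm_form_iff[of m u v w] less.prems by simp
    then obtain u' v' w' where eq: "u = 2 * u'" "v = 2 * v'" "w = 2 * w'"
      by (auto elim!: evenE)
    then have "norm_form m u' v' w' = 0"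
      using less.prems norm_form_scale[of m 2 u' v' w'] by simp
    moreover have "nat (\<bar>u'\<bar> + \<bar>v'\<bar> + \<bar>w'\<bar>) < nat (\<bar>u\<bar> + \<bar>v\<bar> + \<bar>w\<bar>)"
      using nz eq by auto
    ultimately have "u' = 0 \<and> v' = 0 \<and> w' = 0"
      using less.hyps by blast
    with nz eq show False by simp
  qed
qed

lemma norm_form_eq_0_Rats:
  assumes "a \<in> \<rat>" "b \<in> \<rat>" "c \<in> (\<rat> :: complex set)" "norm_form (of_int m) a b c = 0"
  shows "a = 0 \<and> b = 0 \<and> c = 0"
proof -
  obtain d u v w where d: "d > 0" "of_int d * a = of_int u" "of_int d * b = of_int v"
    "of_int d * c = of_int w"
    using Rats_common_denominator[OF assms(1-3)] .
  have "of_int (norm_form m u v w) = (of_int d ^ 3 * norm_form (of_int m) a b c :: complex)"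
    using norm_form_scale[of "of_int m" "of_int d" a b c] d norm_form_of_int[of m u v w, where 'a = complex]
    by simp
  then have "norm_form m u v w = 0"
    using assms by simp
  then have "u = 0 \<and> v = 0 \<and> w = 0"
    by (rule norm_form_eq_0_int)
  with d show ?thesis by auto
qed

section \<open>The simplest cubic field and its cyclic Galois group\<close>

locale simplest_cubic_root =
  fixes m :: int and \<alpha> :: complex
  assumes root: "\<alpha> ^ 3 = of_int m * \<alpha>\<^sup>2 + (of_int m + 3) * \<alpha> + 1"
begin

abbreviation K :: "complex set" where "K \<equiv> rat_adjoin \<alpha>"

text \<open>This is - 1 / (1 + \<alpha>) as a polynomial in \<alpha>; the map t -> - 1 / (1 + t) has
  order 3 and permutes the roots. Applied once more it gives \<open>\<alpha>2\<close>, which is also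
  the trace m minus the other two roots.\<close>

definition \<alpha>1 :: complex where "\<alpha>1 = \<alpha>\<^sup>2 - (of_int m + 1) * \<alpha> - 2"

definition \<alpha>2 :: complex where "\<alpha>2 = of_int m + 2 + of_int m * \<alpha> - \<alpha>\<^sup>2"

lemma conj_e1: "\<alpha> + \<alpha>1 + \<alpha>2 = of_int m"
  unfolding \<alpha>1_def \<alpha>2_def by (simp add: algebra_simps)

lemma conj_e2: "\<alpha> * \<alpha>1 + \<alpha>1 * \<alpha>2 + \<alpha>2 * \<alpha> = - (of_int m + 3)"
  using root unfolding \<alpha>1_def \<alpha>2_def by Groebner_Basis.algebra

lemma conj_e3: "\<alpha> * \<alpha>1 * \<alpha>2 = 1"
  using root unfolding \<alpha>1_def \<alpha>2_def by Groebner_Basis.algebra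

lemma \<alpha>2_conv_\<alpha>1: "\<alpha>2 = \<alpha>1\<^sup>2 - (of_int m + 1) * \<alpha>1 - 2"
  using root unfolding \<alpha>1_def \<alpha>2_def by Groebner_Basis.algebra

lemma \<alpha>_conv_\<alpha>2: "\<alpha> = \<alpha>2\<^sup>2 - (of_int m + 1) * \<alpha>2 - 2"
  using root unfolding \<alpha>1_def \<alpha>2_def by Groebner_Basis.algebra

lemma root_factor:
  "t ^ 3 - (of_int m * t\<^sup>2 + (of_int m + 3) * t + 1) = (t - \<alpha>) * (t - \<alpha>1) * (t - \<alpha>2)"
proof -
  have "(t - \<alpha>) * (t - \<alpha>1) * (t - \<alpha>2) = t ^ 3 - (\<alpha> + \<alpha>1 + \<alpha>2) * t\<^sup>2
    + (\<alpha> * \<alpha>1 + \<alpha>1 * \<alpha>2 + \<alpha>2 * \<alpha>) * t - \<alpha> * \<alpha>1 * \<alpha>2"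
    by (simp add: algebra_simps power2_eq_square power3_eq_cube)
  then show ?thesis
    unfolding conj_e1 conj_e2 conj_e3 by (simp add: algebra_simps)
qed

lemma root1: "\<alpha>1 ^ 3 = of_int m * \<alpha>1\<^sup>2 + (of_int m + 3) * \<alpha>1 + 1"
  and root2: "\<alpha>2 ^ 3 = of_int m * \<alpha>2\<^sup>2 + (of_int m + 3) * \<alpha>2 + 1"
  using root_factor[of \<alpha>1] root_factor[of \<alpha>2] by simp_all

lemma disc_conj: "((\<alpha> - \<alpha>1) * (\<alpha>1 - \<alpha>2) * (\<alpha>2 - \<alpha>))\<^sup>2 = of_int ((m\<^sup>2 + 3 * m + 9)\<^sup>2)"
proof -
  have "M\<^sup>2 * (- (M + 3))\<^sup>2 - 4 * (- (M + 3)) ^ 3 - 4 * M ^ 3 * 1 + 18 * M * (- (M + 3)) * 1 - 27 * 1\<^sup>2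
      = (M\<^sup>2 + 3 * M + 9)\<^sup>2" for M :: complex
    by (simp add: algebra_simps power2_eq_square power3_eq_cube)
  then show ?thesis
    unfolding disc_cubic conj_e1 conj_e2 conj_e3 by simp
qed

text \<open>A relation annihilates one factor of the norm, so the rational triple is a zero of the
  norm form.\<close>

lemma independent:
  assumes "a \<in> \<rat>" "b \<in> \<rat>" "c \<in> \<rat>" "a + b * \<alpha> + c * \<alpha>\<^sup>2 = 0"
  shows "a = 0 \<and> b = 0 \<and> c = 0"
proof -
  have "norm_form (of_int m) a b c = 0"
    using norm_form_prod[OF conj_e1 conj_e2 conj_e3, of a b c] assms by simp
  with assms norm_form_eq_0_Rats show ?thesis by blast
qed

lemma \<alpha>_notin_Rats: "\<alpha> \<notin> \<rat>"
  using independent[of "- \<alpha>" 1 0] by auto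

text \<open>Triples of values of one rational polynomial at \<open>\<alpha>\<close>, \<open>\<alpha>1\<close>, \<open>\<alpha>2\<close>, hence orbits of the Galois group.\<close>

definition conjs :: "complex \<Rightarrow> complex \<Rightarrow> complex \<Rightarrow> bool" where
  "conjs x0 x1 x2 \<longleftrightarrow> (\<exists>a\<in>\<rat>. \<exists>b\<in>\<rat>. \<exists>c\<in>\<rat>. x0 = a + b * \<alpha> + c * \<alpha>\<^sup>2 \<and>
     x1 = a + b * \<alpha>1 + c * \<alpha>1\<^sup>2 \<and> x2 = a + b * \<alpha>2 + c * \<alpha>2\<^sup>2)"

lemma conjsI:
  assumes "a \<in> \<rat>" "b \<in> \<rat>" "c \<in> \<rat>"
  shows "conjs (a + b * \<alpha> + c * \<alpha>\<^sup>2) (a + b * \<alpha>1 + c * \<alpha>1\<^sup>2) (a + b * \<alpha>2 + c * \<alpha>2\<^sup>2)"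
  using assms unfolding conjs_def by blast

lemma conjsE:
  assumes "conjs x0 x1 x2"
  obtains a b c where "a \<in> \<rat>" "b \<in> \<rat>" "c \<in> \<rat>" "x0 = a + b * \<alpha> + c * \<alpha>\<^sup>2"
    "x1 = a + b * \<alpha>1 + c * \<alpha>1\<^sup>2" "x2 = a + b * \<alpha>2 + c * \<alpha>2\<^sup>2"
  using assms unfolding conjs_def by blast

lemma conjs_Rats: "q \<in> \<rat> \<Longrightarrow> conjs q q q"
  using conjsI[of q 0 0] by simp

lemma conjs_\<alpha>: "conjs \<alpha> \<alpha>1 \<alpha>2"
  using conjsI[of 0 1 0] by simp

lemma conjs_add:
  assumes "conjs x0 x1 x2" "conjs y0 y1 y2"
  shows "conjs (x0 + y0) (x1 + y1) (x2 + y2)"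
proof -
  obtain a b c where x: "a \<in> \<rat>" "b \<in> \<rat>" "c \<in> \<rat>" "x0 = a + b * \<alpha> + c * \<alpha>\<^sup>2"
    "x1 = a + b * \<alpha>1 + c * \<alpha>1\<^sup>2" "x2 = a + b * \<alpha>2 + c * \<alpha>2\<^sup>2" using conjsE[OF assms(1)] .
  obtain a' b' c' where y: "a' \<in> \<rat>" "b' \<in> \<rat>" "c' \<in> \<rat>" "y0 = a' + b' * \<alpha> + c' * \<alpha>\<^sup>2"
    "y1 = a' + b' * \<alpha>1 + c' * \<alpha>1\<^sup>2" "y2 = a' + b' * \<alpha>2 + c' * \<alpha>2\<^sup>2" using conjsE[OF assms(2)] .
  have "conjs ((a + a') + (b + b') * \<alpha> + (c + c') * \<alpha>\<^sup>2) ((a + a') + (b + b') * \<alpha>1 + (c + c') * \<alpha>1\<^sup>2)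
    ((a + a') + (b + b') * \<alpha>2 + (c + c') * \<alpha>2\<^sup>2)"
    using x y by (intro conjsI) simp_all
  then show ?thesis unfolding x y by (simp add: algebra_simps)
qed

lemma power_basis_mult:
  assumes "t ^ 3 = M * t\<^sup>2 + (M + 3) * t + (1 :: complex)"
  shows "(a + b * t + c * t\<^sup>2) * (a' + b' * t + c' * t\<^sup>2) =
    (a * a' + (b * c' + c * b') + c * c' * M)
    + (a * b' + b * a' + (M + 3) * (b * c' + c * b') + c * c' * (M\<^sup>2 + 3 * M + 1)) * t
    + (a * c' + b * b' + c * a' + M * (b * c' + c * b') + c * c' * (M\<^sup>2 + M + 3)) * t\<^sup>2"
  using assms by Groebner_Basis.algebra

lemma conjs_mult:
  assumes "conjs x0 x1 x2" "conjs y0 y1 y2"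
  shows "conjs (x0 * y0) (x1 * y1) (x2 * y2)"
proof -
  obtain a b c where x: "a \<in> \<rat>" "b \<in> \<rat>" "c \<in> \<rat>" "x0 = a + b * \<alpha> + c * \<alpha>\<^sup>2"
    "x1 = a + b * \<alpha>1 + c * \<alpha>1\<^sup>2" "x2 = a + b * \<alpha>2 + c * \<alpha>2\<^sup>2" using conjsE[OF assms(1)] .
  obtain a' b' c' where y: "a' \<in> \<rat>" "b' \<in> \<rat>" "c' \<in> \<rat>" "y0 = a' + b' * \<alpha> + c' * \<alpha>\<^sup>2"
    "y1 = a' + b' * \<alpha>1 + c' * \<alpha>1\<^sup>2" "y2 = a' + b' * \<alpha>2 + c' * \<alpha>2\<^sup>2" using conjsE[OF assms(2)] .
  show ?thesis
    unfolding x(4-6) y(4-6) power_basis_mult[OF root] power_basis_mult[OF root1] power_basis_mult[OF root2]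
    using x y by (intro conjsI Rats_add Rats_mult Rats_power) simp_all
qed

lemma conjs_minus: "conjs x0 x1 x2 \<Longrightarrow> conjs (- x0) (- x1) (- x2)"
  using conjs_mult[OF conjs_Rats[of "- 1"]] by simp

lemma conjs_poly:
  assumes "conjs x0 x1 x2" "\<And>i. coeff p i \<in> \<rat>"
  shows "conjs (poly p x0) (poly p x1) (poly p x2)"
  using assms(2)
proof (induction p)
  case 0
  then show ?case using conjs_Rats[of 0] by simp
next
  case (pCons a p)
  have "a \<in> \<rat>" "\<And>i. coeff p i \<in> \<rat>"
    using pCons.prems[of 0] pCons.prems[of "Suc i" for i] by simp_all
  then show ?case
    using pCons.IH conjs_add[OF conjs_Rats conjs_mult[OF assms(1)]] by simp
qed

lemma conjs_eq_0:
  assumes "conjs 0 x1 x2"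
  shows "x1 = 0" "x2 = 0"
proof -
  obtain a b c where x: "a \<in> \<rat>" "b \<in> \<rat>" "c \<in> \<rat>" "0 = a + b * \<alpha> + c * \<alpha>\<^sup>2"
    "x1 = a + b * \<alpha>1 + c * \<alpha>1\<^sup>2" "x2 = a + b * \<alpha>2 + c * \<alpha>2\<^sup>2" using conjsE[OF assms] .
  then show "x1 = 0" "x2 = 0" using independent[of a b c] by auto
qed

text \<open>A monic integer polynomial killing \<open>x0\<close> takes values at the conjugates that
  are conjugate to 0, hence are 0.\<close>

lemma conjs_algebraic_int:
  assumes "conjs x0 x1 x2" "algebraic_int x0"
  shows "algebraic_int x1" "algebraic_int x2"
proof -
  obtain p where p: "lead_coeff p = 1" "\<forall>i. coeff p i \<in> \<int>" "poly p x0 = 0"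
    using assms(2) by (auto elim: algebraic_int.cases)
  have "conjs (poly p x0) (poly p x1) (poly p x2)"
    using p(2) Ints_subset_Rats by (intro conjs_poly assms(1)) blast
  then have "poly p x1 = 0" "poly p x2 = 0"
    using conjs_eq_0 p(3) by simp_all
  with p show "algebraic_int x1" "algebraic_int x2"
    by (blast intro: algebraic_int.intros)+
qed

text \<open>One polynomial sends \<alpha> to \<open>\<alpha>1\<close>, \<open>\<alpha>1\<close> to
  \<open>\<alpha>2\<close> and \<open>\<alpha>2\<close> back to \<alpha>. So the rotated triple of
  roots is again a triple of conjugates, and sums and products carry this over to the whole
  field.\<close>

lemma conjs_rotate:
  assumes "conjs x0 x1 x2"
  shows "conjs x1 x2 x0"
proof -
  obtain a b c where x: "a \<in> \<rat>" "b \<in> \<rat>" "c \<in> \<rat>" "x0 = a + b * \<alpha> + c * \<alpha>\<^sup>2"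
    "x1 = a + b * \<alpha>1 + c * \<alpha>1\<^sup>2" "x2 = a + b * \<alpha>2 + c * \<alpha>2\<^sup>2" using conjsE[OF assms] .
  have "conjs (- 2 + - (of_int m + 1) * \<alpha> + 1 * \<alpha>\<^sup>2) (- 2 + - (of_int m + 1) * \<alpha>1 + 1 * \<alpha>1\<^sup>2)
      (- 2 + - (of_int m + 1) * \<alpha>2 + 1 * \<alpha>2\<^sup>2)"
    by (rule conjsI) simp_all
  moreover have "- 2 + - (of_int m + 1) * \<alpha> + 1 * \<alpha>\<^sup>2 = \<alpha>1"
    by (rule trans[OF _ \<alpha>1_def[symmetric]]) (simp add: algebra_simps)
  moreover have "- 2 + - (of_int m + 1) * \<alpha>1 + 1 * \<alpha>1\<^sup>2 = \<alpha>2"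
    by (rule trans[OF _ \<alpha>2_conv_\<alpha>1[symmetric]]) (simp add: algebra_simps)
  moreover have "- 2 + - (of_int m + 1) * \<alpha>2 + 1 * \<alpha>2\<^sup>2 = \<alpha>"
    by (rule trans[OF _ \<alpha>_conv_\<alpha>2[symmetric]]) (simp add: algebra_simps)
  ultimately have \<alpha>: "conjs \<alpha>1 \<alpha>2 \<alpha>" by (simp only:)
  show ?thesis
    unfolding x power2_eq_square by (intro conjs_add conjs_mult conjs_Rats \<alpha> x(1-3))
qed

text \<open>Elements fixed by the Galois group are rational: the sum of the three representations
  expresses 3 x through power sums of the roots, which are integers.\<close>

lemma conjs_sym_Rats:
  assumes "conjs x x x"
  shows "x \<in> \<rat>"
proof -
  obtain a b c where x: "a \<in> \<rat>" "b \<in> \<rat>" "c \<in> \<rat>" "x = a + b * \<alpha> + c * \<alpha>\<^sup>2"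
    "x = a + b * \<alpha>1 + c * \<alpha>1\<^sup>2" "x = a + b * \<alpha>2 + c * \<alpha>2\<^sup>2" using conjsE[OF assms] .
  have "3 * x = 3 * a + b * (\<alpha> + \<alpha>1 + \<alpha>2) + c * ((\<alpha> + \<alpha>1 + \<alpha>2)\<^sup>2 - 2 * (\<alpha> * \<alpha>1 + \<alpha>1 * \<alpha>2 + \<alpha>2 * \<alpha>))"
    using x(4-6) by Groebner_Basis.algebra
  also have "\<dots> = 3 * a + b * of_int m + c * ((of_int m)\<^sup>2 - 2 * - (of_int m + 3))"
    (is "_ = ?r") unfolding conj_e1 conj_e2 ..
  finally have "3 * x / 3 = ?r / 3" by (rule arg_cong)
  then have "x = ?r / 3" by simp
  also have "\<dots> \<in> \<rat>" using x(1-3) by simp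
  finally show ?thesis .
qed

text \<open>Combining a triple with its two rotations gives a constant triple; the next two lemmas
  use the same device for the other symmetric functions.\<close>

lemma conjs_e1_Rats:
  assumes "conjs x0 x1 x2" shows "x0 + x1 + x2 \<in> \<rat>"
  using conjs_add[OF conjs_add[OF assms conjs_rotate[OF assms]] conjs_rotate[OF conjs_rotate[OF assms]]]
  by (intro conjs_sym_Rats) (simp add: add_ac)

lemma conjs_e2_Rats:
  assumes "conjs x0 x1 x2" shows "x0 * x1 + x1 * x2 + x2 * x0 \<in> \<rat>"
  using conjs_e1_Rats[OF conjs_mult[OF assms conjs_rotate[OF assms]]] by simp

lemma conjs_e3_Rats:
  assumes "conjs x0 x1 x2" shows "x0 * x1 * x2 \<in> \<rat>"
  using conjs_mult[OF conjs_mult[OF assms conjs_rotate[OF assms]] conjs_rotate[OF conjs_rotate[OF assms]]]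
  by (intro conjs_sym_Rats) (simp add: mult_ac)

text \<open>The inverse is the product of the other two conjugates divided by the norm, which is
  rational.\<close>

lemma conjs_inverse:
  assumes "conjs x0 x1 x2" "x0 \<noteq> 0"
  shows "\<exists>y1 y2. conjs (inverse x0) y1 y2"
proof -
  define q where "q = inverse (x0 * x1 * x2)"
  have q: "q \<in> \<rat>" unfolding q_def by (intro Rats_inverse conjs_e3_Rats assms)
  have "x1 \<noteq> 0" "x2 \<noteq> 0"
    using conjs_eq_0(1)[of x2 x0] conjs_eq_0(1)[of x0 x1] conjs_rotate[OF assms(1)]
      conjs_rotate[OF conjs_rotate[OF assms(1)]] assms(2) conjs_eq_0(2) by auto
  moreover have "x1 * x2 * q = inverse x0 * ((x1 * inverse x1) * (x2 * inverse x2))"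
    by (simp only: q_def inverse_mult_distrib mult_ac)
  ultimately have "inverse x0 = x1 * x2 * q" by simp
  moreover have "conjs (x1 * x2 * q) (x2 * x0 * q) (x0 * x1 * q)"
    using conjs_rotate[OF assms(1)] by (intro conjs_mult conjs_Rats q) (blast intro: conjs_rotate)+
  ultimately show ?thesis by auto
qed

text \<open>The first entries of conjugate triples form a field containing \<alpha>, so minimality
  of the generated field gives one inclusion.\<close>

lemma K_iff: "x \<in> K \<longleftrightarrow> (\<exists>x1 x2. conjs x x1 x2)"
proof
  have "K \<subseteq> {x. \<exists>x1 x2. conjs x x1 x2}"
  proof (rule rat_adjoin_subset, unfold mem_Collect_eq)
    show "\<exists>x1 x2. conjs \<alpha> x1 x2" using conjs_\<alpha> by blast
    show "\<exists>x1 x2. conjs 1 x1 x2" using conjs_Rats[of 1] by auto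
    show "\<exists>z1 z2. conjs (x + y) z1 z2" if "\<exists>x1 x2. conjs x x1 x2" "\<exists>x1 x2. conjs y x1 x2" for x y
      using that conjs_add by blast
    show "\<exists>z1 z2. conjs (x * y) z1 z2" if "\<exists>x1 x2. conjs x x1 x2" "\<exists>x1 x2. conjs y x1 x2" for x y
      using that conjs_mult by blast
    show "\<exists>z1 z2. conjs (- x) z1 z2" if "\<exists>x1 x2. conjs x x1 x2" for x
      using that conjs_minus by blast
    show "\<exists>z1 z2. conjs (inverse x) z1 z2" if "\<exists>x1 x2. conjs x x1 x2" "x \<noteq> 0" for x
      using that conjs_inverse by blast
  qed
  then show "\<exists>x1 x2. conjs x x1 x2" if "x \<in> K" using that by blast
  show "x \<in> K" if ex: "\<exists>x1 x2. conjs x x1 x2"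
  proof -
    obtain a b c where abc: "a \<in> \<rat>" "b \<in> \<rat>" "c \<in> \<rat>" "x = a + b * \<alpha> + c * \<alpha>\<^sup>2"
      using ex conjsE by metis
    show ?thesis
      unfolding abc(4) power2_eq_square
      by (intro rat_adjoin_add rat_adjoin_mult rat_adjoin_incl rat_adjoin_Rats abc)
  qed
qed

text \<open>The determinant of \<open>1, x, x\<^sup>2\<close> over \<open>1, \<alpha>, \<alpha>\<^sup>2\<close> is the norm of \<open>b + c * m - c * \<alpha>\<close>.\<close>

lemma conjs_generator:
  assumes x: "conjs x0 x1 x2" and nr: "x0 \<notin> \<rat>"
  obtains u v w where "u \<in> \<rat>" "v \<in> \<rat>" "w \<in> \<rat>" "\<alpha> = u + v * x0 + w * x0\<^sup>2"
    "\<alpha>1 = u + v * x1 + w * x1\<^sup>2" "\<alpha>2 = u + v * x2 + w * x2\<^sup>2"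
proof -
  obtain a b c where abc: "a \<in> \<rat>" "b \<in> \<rat>" "c \<in> \<rat>" "x0 = a + b * \<alpha> + c * \<alpha>\<^sup>2"
    "x1 = a + b * \<alpha>1 + c * \<alpha>1\<^sup>2" "x2 = a + b * \<alpha>2 + c * \<alpha>2\<^sup>2" using conjsE[OF x] .
  define M :: complex where "M = of_int m"
  have M: "M \<in> \<rat>" by (simp add: M_def)
  \<comment> \<open>\<open>A\<close>, \<open>B\<close>, \<open>C\<close> are the coordinates of the
    square of \<open>x0\<close> over 1, \<alpha>, \<alpha>^2.\<close>
  define A where "A = a * a + (b * c + c * b) + c * c * M"
  define B where "B = a * b + b * a + (M + 3) * (b * c + c * b) + c * c * (M\<^sup>2 + 3 * M + 1)"
  define C where "C = a * c + b * b + c * a + M * (b * c + c * b) + c * c * (M\<^sup>2 + M + 3)"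
  define J where "J = b * C - c * B"
  have rat: "A \<in> \<rat>" "B \<in> \<rat>" "C \<in> \<rat>" "J \<in> \<rat>"
    unfolding A_def B_def C_def J_def using abc M by simp_all
  have J: "J = norm_form M (b + c * M) (- c) 0"
    unfolding J_def B_def C_def norm_form_def by (simp add: algebra_simps power2_eq_square power3_eq_cube)
  have "J \<noteq> 0"
  proof
    assume "J = 0"
    then have "b + c * M = 0 \<and> - c = 0 \<and> (0 :: complex) = 0"
      using J abc M by (intro norm_form_eq_0_Rats[where m = m]) (simp_all add: M_def)
    then have c: "c = 0" by simp
    with \<open>_ \<and> _\<close> have "b = 0" by simp
    with c have "x0 = a" using abc(4) by simp
    with abc nr show False by simp
  qed
  \<comment> \<open>Eliminating t^2 from the expressions of x and x^2 leaves \<open>J * t\<close>.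
    One rational formula therefore recovers all three roots from the corresponding
    conjugates.\<close>
  have sol: "t = (c * A - C * a) / J + C / J * x + (- c / J) * x\<^sup>2"
    if t: "t ^ 3 = M * t\<^sup>2 + (M + 3) * t + 1" and xt: "x = a + b * t + c * t\<^sup>2" for t x
  proof -
    have "x\<^sup>2 = A + B * t + C * t\<^sup>2"
      unfolding A_def B_def C_def power_basis_mult[OF t, symmetric] xt power2_eq_square[of "a + _ + _"] ..
    then have "J * t = (c * A - C * a) + C * x - c * x\<^sup>2"
      unfolding J_def xt by Groebner_Basis.algebra
    then have "t = ((c * A - C * a) + C * x - c * x\<^sup>2) / J"
      using \<open>J \<noteq> 0\<close> by (metis nonzero_mult_div_cancel_left)
    then show ?thesis by (simp add: add_divide_distrib diff_divide_distrib)
  qed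
  show ?thesis
  proof (rule that)
    show "\<alpha> = (c * A - C * a) / J + C / J * x0 + (- c / J) * x0\<^sup>2"
      using sol[of \<alpha> x0] root abc by (simp add: M_def)
    show "\<alpha>1 = (c * A - C * a) / J + C / J * x1 + (- c / J) * x1\<^sup>2"
      using sol[of \<alpha>1 x1] root1 abc by (simp add: M_def)
    show "\<alpha>2 = (c * A - C * a) / J + C / J * x2 + (- c / J) * x2\<^sup>2"
      using sol[of \<alpha>2 x2] root2 abc by (simp add: M_def)
  qed (use rat abc in simp_all)
qed

lemma odd_disc: "odd (m\<^sup>2 + 3 * m + 9)"
  by simp

text \<open>The roots are the values of one quadratic polynomial at the conjugates, so equal
  conjugates would give equal roots. The discriminant excludes this, as it is odd and thus
  nonzero.\<close>

lemma conjs_distinct: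
  assumes "conjs x0 x1 x2" "x0 \<notin> \<rat>"
  shows "x0 \<noteq> x1" "x1 \<noteq> x2" "x2 \<noteq> x0"
proof -
  obtain u v w where "\<alpha> = u + v * x0 + w * x0\<^sup>2"
    "\<alpha>1 = u + v * x1 + w * x1\<^sup>2" "\<alpha>2 = u + v * x2 + w * x2\<^sup>2"
    using conjs_generator[OF assms] by metis
  moreover have "\<alpha> \<noteq> \<alpha>1 \<and> \<alpha>1 \<noteq> \<alpha>2 \<and> \<alpha>2 \<noteq> \<alpha>"
  proof -
    have "m\<^sup>2 + 3 * m + 9 \<noteq> 0" using odd_disc by (metis even_zero)
    then have "of_int ((m\<^sup>2 + 3 * m + 9)\<^sup>2) \<noteq> (0 :: complex)"
      by (simp only: of_int_eq_0_iff zero_eq_power2 not_False_eq_True)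
    with disc_conj show ?thesis by auto
  qed
  ultimately show "x0 \<noteq> x1" "x1 \<noteq> x2" "x2 \<noteq> x0" by auto
qed

text \<open>A rational relation carries over to all conjugates, and a polynomial of degree at most 2
  with three distinct zeros is 0.\<close>

lemma conjs_independent:
  assumes x: "conjs x0 x1 x2" "x0 \<notin> \<rat>"
    and rat: "p \<in> \<rat>" "q \<in> \<rat>" "r \<in> \<rat>" and eq: "p + q * x0 + r * x0\<^sup>2 = 0"
  shows "p = 0 \<and> q = 0 \<and> r = 0"
proof -
  have "conjs (p + q * x0 + r * x0\<^sup>2) (p + q * x1 + r * x1\<^sup>2) (p + q * x2 + r * x2\<^sup>2)"
    unfolding power2_eq_square by (intro conjs_add conjs_mult conjs_Rats rat x(1))
  then have "p + q * x1 + r * x1\<^sup>2 = 0" "p + q * x2 + r * x2\<^sup>2 = 0"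
    using conjs_eq_0 eq by simp_all
  with eq have "(x0 - x1) * (q + r * (x0 + x1)) = 0" "(x1 - x2) * (q + r * (x1 + x2)) = 0"
    by Groebner_Basis.algebra+
  then have *: "q + r * (x0 + x1) = 0" "q + r * (x1 + x2) = 0"
    using conjs_distinct[OF x] by simp_all
  then have "r * (x2 - x0) = 0"
    by Groebner_Basis.algebra
  then have "r = 0"
    using conjs_distinct[OF x] by simp
  with * eq show ?thesis by simp
qed

text \<open>In a cubic field every irrational element is primitive: \<open>conjs_generator\<close>
  writes \<alpha> as a rational polynomial in it.\<close>

lemma primitive_integers_iff:
  "x \<in> primitive_integers K \<longleftrightarrow> x \<in> K \<and> algebraic_int x \<and> x \<notin> \<rat>"
proof -
  have "K = rat_adjoin x \<longleftrightarrow> x \<notin> \<rat>" if xK: "x \<in> K"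
  proof
    assume "K = rat_adjoin x"
    then show "x \<notin> \<rat>"
      using rat_adjoin_Rats_subset[of x] rat_adjoin_incl[of \<alpha>] \<alpha>_notin_Rats by auto
  next
    assume "x \<notin> \<rat>"
    obtain x1 x2 where "conjs x x1 x2" using xK K_iff[of x] by blast
    from conjs_generator[OF this \<open>x \<notin> \<rat>\<close>]
    obtain u v w where uvw: "u \<in> \<rat>" "v \<in> \<rat>" "w \<in> \<rat>" "\<alpha> = u + v * x + w * x\<^sup>2" .
    have "\<alpha> \<in> rat_adjoin x"
      unfolding uvw(4) power2_eq_square
      by (intro rat_adjoin_add rat_adjoin_mult rat_adjoin_incl rat_adjoin_Rats uvw)
    with xK show "K = rat_adjoin x"
      using rat_adjoin_least by blast
  qed
  then show ?thesis
    by (auto simp: primitive_integers_def ring_of_integers_def)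
qed

section \<open>Multiplication matrices and characteristic polynomials\<close>

lemma K_basis_iff:
  "x \<in> K \<longleftrightarrow> (\<exists>a\<in>\<rat>. \<exists>b\<in>\<rat>. \<exists>c\<in>\<rat>. x = a + b * \<alpha> + c * \<alpha>\<^sup>2)"
  unfolding K_iff conjs_def by blast

lemma power_basis_distinct: "1 \<noteq> \<alpha>" "1 \<noteq> \<alpha>\<^sup>2" "\<alpha> \<noteq> \<alpha>\<^sup>2"
  using independent[of 1 "-1" 0] independent[of 1 0 "-1"] independent[of 0 1 "-1"] by auto

lemma is_rat_basis_power: "is_rat_basis K [1, \<alpha>, \<alpha>\<^sup>2]"
  unfolding is_rat_basis_def
proof (intro conjI)
  have sum: "(\<Sum>v\<in>{1, \<alpha>, \<alpha>\<^sup>2}. rat_scale (u v) v) = of_rat (u 1) + of_rat (u \<alpha>) * \<alpha> + of_rat (u (\<alpha>\<^sup>2)) * \<alpha>\<^sup>2"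
    for u using power_basis_distinct by simp
  show "distinct [1, \<alpha>, \<alpha>\<^sup>2]" using power_basis_distinct by simp
  show "rat_vs.independent (set [1, \<alpha>, \<alpha>\<^sup>2])"
  proof
    assume "rat_vs.dependent (set [1, \<alpha>, \<alpha>\<^sup>2])"
    then obtain u where u: "\<exists>v\<in>{1, \<alpha>, \<alpha>\<^sup>2}. u v \<noteq> 0" "(\<Sum>v\<in>{1, \<alpha>, \<alpha>\<^sup>2}. rat_scale (u v) v) = 0"
      using rat_vs.dependent_finite[of "{1, \<alpha>, \<alpha>\<^sup>2}"] by auto
    have "of_rat (u 1) = (0 :: complex) \<and> of_rat (u \<alpha>) = (0 :: complex) \<and> of_rat (u (\<alpha>\<^sup>2)) = (0 :: complex)"
      using u(2) unfolding sum by (intro independent) simp_all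
    with u(1) show False by simp
  qed
  show "rat_vs.span (set [1, \<alpha>, \<alpha>\<^sup>2]) = K"
  proof (rule Set.set_eqI)
    fix x
    have "x \<in> rat_vs.span {1, \<alpha>, \<alpha>\<^sup>2} \<longleftrightarrow>
      (\<exists>u. x = of_rat (u 1) + of_rat (u \<alpha>) * \<alpha> + of_rat (u (\<alpha>\<^sup>2)) * \<alpha>\<^sup>2)"
      unfolding rat_vs.span_finite[of "{1, \<alpha>, \<alpha>\<^sup>2}", simplified] image_iff sum[symmetric] by simp
    also have "\<dots> \<longleftrightarrow> x \<in> K"
    proof
      assume "x \<in> K"
      then obtain a b c where abc: "x = of_rat a + of_rat b * \<alpha> + of_rat c * \<alpha>\<^sup>2"
        unfolding K_basis_iff Rats_def by blast
      then show "\<exists>u. x = of_rat (u 1) + of_rat (u \<alpha>) * \<alpha> + of_rat (u (\<alpha>\<^sup>2)) * \<alpha>\<^sup>2"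
        using power_basis_distinct
        by (intro exI[of _ "\<lambda>v. if v = 1 then a else if v = \<alpha> then b else c"]) auto
    next
      assume "\<exists>u. x = of_rat (u 1) + of_rat (u \<alpha>) * \<alpha> + of_rat (u (\<alpha>\<^sup>2)) * \<alpha>\<^sup>2"
      then show "x \<in> K"
        unfolding K_basis_iff using Rats_of_rat by blast
    qed
    finally show "x \<in> rat_vs.span (set [1, \<alpha>, \<alpha>\<^sup>2]) \<longleftrightarrow> x \<in> K" by simp
  qed
qed

lemma is_rat_basis_length:
  assumes "is_rat_basis K bs"
  shows "length bs = 3"
proof -
  have "rat_vs.dim K = card (set bs)" if "is_rat_basis K bs" for bs
    using that rat_vs.dim_eq_card[of "set bs" K] rat_vs.span_span[of "set bs"]
    unfolding is_rat_basis_def by metis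
  from this[OF assms] this[OF is_rat_basis_power] assms power_basis_distinct show ?thesis
    by (simp add: is_rat_basis_def distinct_card)
qed

text \<open>By construction of the matrix, the basis vectors form an eigenvector of its transpose.
  This covers every rational basis, hence the one picked by \<open>SOME\<close>.\<close>

lemma mult_matrix_root:
  assumes bs: "is_rat_basis K bs" and x: "x \<in> K"
  shows "poly (map_poly of_rat (char_poly (mult_matrix bs x))) x = 0"
proof -
  define M where "M = mult_matrix bs x"
  have M: "M \<in> carrier_mat (length bs) (length bs)"
    by (simp add: M_def mult_matrix_def)
  have ind: "rat_vs.independent (set bs)" and span: "rat_vs.span (set bs) = K" and dist: "distinct bs"
    using bs by (auto simp: is_rat_basis_def)
  have "\<exists>b\<in>set bs. b \<noteq> 0"
  proof (rule ccontr)
    assume "\<not> ?thesis"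
    then have "set bs \<subseteq> {0}" by blast
    then have "rat_vs.span (set bs) \<subseteq> {0}"
      using rat_vs.span_mono[of "set bs" "{0}"] rat_vs.span_insert_0[of "{}"] rat_vs.span_empty by simp
    then have "K \<subseteq> {0}" unfolding span .
    then have "1 \<in> {0 :: complex}" using rat_adjoin_one[of \<alpha>] by (rule subsetD)
    then show False by simp
  qed
  then obtain b where b: "b \<in> set bs" "b \<noteq> 0" by blast
  have "poly (char_poly (map_mat of_rat M)) x = 0"
  proof (rule char_poly_root_if_eigenvector[OF _ b])
    show "map_mat of_rat M \<in> carrier_mat (length bs) (length bs)" using M by simp
    fix j assume j: "j < length bs"
    let ?r = "\<lambda>v. rat_vs.representation (set bs) (x * bs ! j) v"
    have "bs ! j \<in> K" using rat_vs.span_base[of "bs ! j" "set bs"] j unfolding span by simp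
    then have "x * bs ! j \<in> rat_vs.span (set bs)"
      unfolding span using x by (intro rat_adjoin_mult)
    then have "x * bs ! j = (\<Sum>v\<in>set bs. rat_scale (?r v) v)"
      using rat_vs.sum_representation_eq[OF ind, of "x * bs ! j" "set bs"] by simp
    also have "\<dots> = (\<Sum>i<length bs. rat_scale (?r (bs ! i)) (bs ! i))"
      using sum.reindex_bij_betw[OF bij_betw_nth[OF dist refl refl], of "\<lambda>v. rat_scale (?r v) v"] by simp
    also have "\<dots> = (\<Sum>i<length bs. map_mat of_rat M $$ (i, j) * bs ! i)"
      using j by (simp add: M_def mult_matrix_def)
    finally show "x * bs ! j = (\<Sum>i<length bs. map_mat of_rat M $$ (i, j) * bs ! i)" .
  qed
  then show ?thesis
    unfolding M_def[symmetric] by (simp only: of_rat_hom.char_poly_hom[OF M])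
qed

text \<open>The characteristic polynomial is monic of degree 3 with root x, and only one rational
  polynomial has these properties when x is irrational. A single cubic equation thus determines
  \<open>int_char_poly\<close>.\<close>

lemma int_char_poly_eqI:
  assumes x: "x \<in> K" "x \<notin> \<rat>" and F: "x ^ 3 + of_int c2 * x\<^sup>2 + of_int c1 * x + of_int c0 = 0"
  shows "int_char_poly K x = [:c0, c1, c2, 1:]"
proof -
  define bs where "bs = (SOME bs. is_rat_basis K bs)"
  have bs: "is_rat_basis K bs"
    unfolding bs_def by (rule someI_ex) (use is_rat_basis_power in blast)
  define G where "G = char_poly (mult_matrix bs x)"
  have "mult_matrix bs x \<in> carrier_mat 3 3"
    using is_rat_basis_length[OF bs] by (simp add: mult_matrix_def)
  then have deg: "degree G = 3" "coeff G 3 = 1"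
    unfolding G_def using degree_monic_char_poly by blast+
  have G: "G = [:coeff G 0, coeff G 1, coeff G 2, 1:]"
  proof (rule poly_eqI)
    fix n
    consider "n = 0" | "n = 1" | "n = 2" | "n = 3" | k where "n = Suc (Suc (Suc (Suc k)))"
      by (metis One_nat_def Suc_1 numeral_3_eq_3 not0_implies_Suc)
    then show "coeff G n = coeff [:coeff G 0, coeff G 1, coeff G 2, 1:] n"
      by cases (use deg in \<open>simp_all add: numeral_2_eq_2 numeral_3_eq_3 coeff_eq_0\<close>)
  qed
  define g0 g1 g2 where g: "g0 = coeff G 0" "g1 = coeff G 1" "g2 = coeff G 2"
  have "poly (map_poly of_rat G) x = 0"
    unfolding G_def by (rule mult_matrix_root[OF bs x(1)])
  then have "poly (map_poly of_rat [:g0, g1, g2, 1:]) x = 0"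
    unfolding g using G by simp
  then have "x ^ 3 + of_rat g2 * x\<^sup>2 + of_rat g1 * x + of_rat g0 = 0"
    by (simp add: algebra_simps power2_eq_square power3_eq_cube)
  \<comment> \<open>The difference of two monic cubics has degree at most 2, so independence of 1,
    x, x^2 applies.\<close>
  with F have lin: "(of_rat g0 - of_int c0) + (of_rat g1 - of_int c1) * x + (of_rat g2 - of_int c2) * x\<^sup>2 = 0"
    by Groebner_Basis.algebra
  obtain x1 x2 where conj: "conjs x x1 x2" using x K_iff[of x] by blast
  have "of_rat g0 - of_int c0 = (0 :: complex) \<and> of_rat g1 - of_int c1 = (0 :: complex)
      \<and> of_rat g2 - of_int c2 = (0 :: complex)"
    by (rule conjs_independent[OF conj x(2) _ _ _ lin]) simp_all
  then have "of_rat g0 = (of_rat (of_int c0) :: complex)" "of_rat g1 = (of_rat (of_int c1) :: complex)"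
      "of_rat g2 = (of_rat (of_int c2) :: complex)"
    by simp_all
  then have "g0 = of_int c0" "g1 = of_int c1" "g2 = of_int c2"
    by (simp_all only: of_rat_eq_iff)
  with G g have eq: "map_poly of_int [:c0, c1, c2, 1:] = rat_char_poly K x"
    unfolding rat_char_poly_def bs_def[symmetric] G_def[symmetric] by simp
  show ?thesis
    unfolding int_char_poly_def
  proof (rule the_equality)
    show "map_poly of_int [:c0, c1, c2, 1:] = rat_char_poly K x" by (rule eq)
    fix F assume "map_poly of_int F = rat_char_poly K x"
    with eq have "(map_poly of_int F :: rat poly) = map_poly of_int [:c0, c1, c2, 1:]" by simp
    then show "F = [:c0, c1, c2, 1:]"
      unfolding of_int_poly_hom.eq_iff .
  qed
qed

end

section \<open>Roots of cubics modulo powers of 3\<close>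

text \<open>Division of p by the monic cubic, with the remainder read both at the complex root x and
  at an integer r modulo the value of the cubic there. It transports polynomial equations satisfied
  by x to congruences at r.\<close>

lemma int_poly_reduce_cubic:
  fixes x :: complex and T S N r :: int
  assumes x: "x ^ 3 = of_int T * x\<^sup>2 - of_int S * x + of_int N"
  shows "\<exists>A B C. poly (map_poly of_int p) x = of_int A + of_int B * x + of_int C * x\<^sup>2 \<and>
    (r ^ 3 - T * r\<^sup>2 + S * r - N) dvd poly p r - (A + B * r + C * r\<^sup>2)"
proof (induction p)
  case 0
  show ?case by (intro exI[of _ 0]) simp
next
  case (pCons a p)
  then obtain A B C where ABC: "poly (map_poly of_int p) x = of_int A + of_int B * x + of_int C * x\<^sup>2"
    "(r ^ 3 - T * r\<^sup>2 + S * r - N) dvd poly p r - (A + B * r + C * r\<^sup>2)" by blast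
  have "poly (map_poly of_int (pCons a p)) x = of_int a + x * (of_int A + of_int B * x + of_int C * x\<^sup>2)"
    using ABC(1) by (simp add: of_int_hom.map_poly_pCons_hom)
  also have "\<dots> = of_int (a + C * N) + of_int (A - C * S) * x + of_int (B + C * T) * x\<^sup>2"
    unfolding of_int_add of_int_diff of_int_mult using x by Groebner_Basis.algebra
  finally have 1: "poly (map_poly of_int (pCons a p)) x = \<dots>" .
  have "poly (pCons a p) r - ((a + C * N) + (A - C * S) * r + (B + C * T) * r\<^sup>2) =
    r * (poly p r - (A + B * r + C * r\<^sup>2)) + C * (r ^ 3 - T * r\<^sup>2 + S * r - N)"
    by (simp add: algebra_simps power2_eq_square power3_eq_cube)
  then have 2: "(r ^ 3 - T * r\<^sup>2 + S * r - N) dvd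
      poly (pCons a p) r - ((a + C * N) + (A - C * S) * r + (B + C * T) * r\<^sup>2)"
    using ABC(2) by simp
  from 1 2 show ?case by blast
qed

text \<open>Hensel lifting of the root 0 of x^3 - x mod 3. The derivative there is - 1 mod 3 at
  every integer.\<close>

lemma cubic_root_mod_power_3:
  fixes T S N :: int
  assumes "3 dvd T" "3 dvd S + 1" "3 dvd N"
  shows "\<exists>r. 3 ^ Suc k dvd r ^ 3 - T * r\<^sup>2 + S * r - N"
proof (induction k)
  case 0
  then show ?case using assms by (intro exI[of _ 0]) simp
next
  case (Suc k)
  then obtain r where r: "3 ^ Suc k dvd r ^ 3 - T * r\<^sup>2 + S * r - N" by blast
  \<comment> \<open>With - 1 in place of the derivative, the Newton step is r + h for the value h at
    r.\<close>
  define h where "h = r ^ 3 - T * r\<^sup>2 + S * r - N"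
  have "3 dvd h" using r unfolding h_def[symmetric] by (meson dvd_power dvd_trans zero_less_Suc)
  \<comment> \<open>The second factor is 1 plus the derivative at r plus multiples of h, hence
    divisible by 3.\<close>
  have eq: "(r + h) ^ 3 - T * (r + h)\<^sup>2 + S * (r + h) - N =
      h * ((S + 1) + 3 * r\<^sup>2 - 2 * T * r + h * (3 * r - T) + h * h)"
    unfolding h_def by (simp add: algebra_simps power2_eq_square power3_eq_cube)
  obtain t s h' where "T = 3 * t" "S + 1 = 3 * s" "h = 3 * h'"
    using assms \<open>3 dvd h\<close> unfolding dvd_def by blast
  then have "(S + 1) + 3 * r\<^sup>2 - 2 * T * r + h * (3 * r - T) + h * h =
      3 * (s + r\<^sup>2 - 2 * t * r + h' * (3 * r - 3 * t) + h' * h)"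
    by (simp only:) (simp add: algebra_simps)
  then have "3 dvd (S + 1) + 3 * r\<^sup>2 - 2 * T * r + h * (3 * r - T) + h * h"
    by (simp only: dvd_triv_left)
  then have "3 ^ Suc k * 3 dvd h * ((S + 1) + 3 * r\<^sup>2 - 2 * T * r + h * (3 * r - T) + h * h)"
    using r unfolding h_def[symmetric] by (rule mult_dvd_mono[rotated])
  then show ?case
    unfolding eq[symmetric] by (metis power_Suc2)
qed

text \<open>Modulo 3 only y = 1 can be a root. The simplest cubic for m = 39 vanishes mod 81 at
  every such y, and the cubics for m and 39 differ by (m - 39) (y^2 + y), where the last factor is
  prime to 3.\<close>

lemma simplest_cubic_root_mod_81:
  fixes m y :: int
  assumes "81 dvd y ^ 3 - m * y\<^sup>2 - (m + 3) * y - 1"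
  shows "81 dvd m - 39"
proof -
  have dvd3: "3 dvd y ^ 3 - m * y\<^sup>2 - (m + 3) * y - 1"
    using assms by (rule dvd_trans[rotated]) simp
  have 3: "\<not> 3 dvd 3 * n - 1" "\<not> 3 dvd 3 * n + 1" "\<not> 3 dvd 3 * n + 2" for n :: int
    by presburger+
  have "y mod 3 = 1"
  proof -
    define z where "z = y div 3"
    have "y = 3 * z + y mod 3" by (simp add: z_def)
    moreover have "y mod 3 = 0 \<or> y mod 3 = 1 \<or> y mod 3 = 2" by presburger
    moreover have False if "y = 3 * z"
    proof -
      have "y ^ 3 - m * y\<^sup>2 - (m + 3) * y - 1 = 3 * (9 * z ^ 3 - 3 * m * z\<^sup>2 - (m + 3) * z) - 1"
        unfolding that by (simp add: algebra_simps power2_eq_square power3_eq_cube)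
      with dvd3 3 show False by (simp only:)
    qed
    moreover have False if "y = 3 * z + 2"
    proof -
      have "y ^ 3 - m * y\<^sup>2 - (m + 3) * y - 1 =
          3 * (9 * z ^ 3 + 18 * z\<^sup>2 + 12 * z - 3 * m * z\<^sup>2 - 5 * m * z - 2 * m - 3 * z) + 1"
        unfolding that by (simp add: algebra_simps power2_eq_square power3_eq_cube)
      with dvd3 3 show False by (simp only:)
    qed
    ultimately show ?thesis by auto
  qed
  then obtain z where z: "y = 1 + 3 * z"
    by (metis mult_div_mod_eq add.commute)
  have "3 dvd z ^ 3 - z"
  proof -
    have "z mod 3 = 0 \<or> z mod 3 = 1 \<or> z mod 3 = 2" by presburger
    then have "z ^ 3 mod 3 = z mod 3"
      by (elim disjE) (simp_all flip: power_mod[of z 3])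
    then show ?thesis by (simp add: mod_eq_dvd_iff)
  qed
  then obtain k where k: "z ^ 3 = z + 3 * k"
    by (metis add.commute diff_add_cancel dvdE)
  \<comment> \<open>The number 39 solves - 2 m - 3 = 0 mod 81, where the left side is the value of
    the simplest cubic at 1. The last bracket is the cubic for 39 at 1 + 3 z.\<close>
  have "(m - 39) * (y\<^sup>2 + y) = - (y ^ 3 - m * y\<^sup>2 - (m + 3) * y - 1) + (27 * z ^ 3 - 324 * z\<^sup>2 - 351 * z - 81)"
    unfolding z by (simp add: algebra_simps power2_eq_square power3_eq_cube)
  also have "27 * z ^ 3 - 324 * z\<^sup>2 - 351 * z - 81 = 81 * (k - 4 * z\<^sup>2 - 4 * z - 1)"
    unfolding k by (simp add: algebra_simps)
  finally have "81 dvd (m - 39) * (y\<^sup>2 + y)"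
    using assms by (metis dvd_add dvd_minus_iff dvd_triv_left)
  moreover have "Rings.coprime 81 (y\<^sup>2 + y)"
  proof -
    have "y\<^sup>2 + y = 3 * (3 * z + 3 * z\<^sup>2) + 2"
      unfolding z by (simp add: algebra_simps power2_eq_square)
    with 3 have "\<not> 3 dvd y\<^sup>2 + y" by (simp only:) blast
    then have "Rings.coprime (3 ^ 4) (y\<^sup>2 + y)"
      by (intro coprime_power_left_iff[THEN iffD2] disjI1 prime_imp_coprime) simp_all
    then show ?thesis by simp
  qed
  ultimately show ?thesis
    by (simp add: coprime_dvd_mult_left_iff)
qed

text \<open>The dividend is e^3 times the simplest cubic at Y / e, and e has an inverse g mod 81, so
  g Y is a root.\<close>

lemma simplest_cubic_scaled_root_mod_81:
  fixes m e Y :: int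
  assumes "81 dvd Y ^ 3 - m * e * Y\<^sup>2 - (m + 3) * e\<^sup>2 * Y - e ^ 3" "\<not> 3 dvd e"
  shows "81 dvd m - 39"
proof -
  have "Rings.coprime e (3 ^ 4)"
    by (intro coprime_power_right_iff[THEN iffD2] disjI1)
      (use assms(2) prime_imp_coprime[of 3 e] in \<open>simp add: coprime_commute\<close>)
  then obtain g where "[e * g = 1] (mod 81)"
    using cong_solve_coprime_int[of e 81] by auto
  then obtain k where k: "g * e = 1 + 81 * k"
    by (metis cong_iff_lin cong_sym mult.commute)
  define y where "y = g * Y"
  have "81 dvd g ^ 3 * (Y ^ 3 - m * e * Y\<^sup>2 - (m + 3) * e\<^sup>2 * Y - e ^ 3)"
    using assms(1) by simp
  also have "g ^ 3 * (Y ^ 3 - m * e * Y\<^sup>2 - (m + 3) * e\<^sup>2 * Y - e ^ 3) =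
      y ^ 3 - m * (g * e) * y\<^sup>2 - (m + 3) * (g * e)\<^sup>2 * y - (g * e) ^ 3"
    unfolding y_def by (simp add: algebra_simps power2_eq_square power3_eq_cube)
  also have "\<dots> = (y ^ 3 - m * y\<^sup>2 - (m + 3) * y - 1)
      - 81 * (m * k * y\<^sup>2 + (m + 3) * (2 * k + 81 * k\<^sup>2) * y + 3 * k + 3 * 81 * k\<^sup>2 + 81\<^sup>2 * k ^ 3)"
    unfolding k by (simp add: algebra_simps power2_eq_square power3_eq_cube)
  finally have "81 dvd y ^ 3 - m * y\<^sup>2 - (m + 3) * y - 1"
    by (metis diff_add_cancel dvd_add dvd_triv_left)
  then show ?thesis by (rule simplest_cubic_root_mod_81)
qed

section \<open>Common divisors of the values of characteristic polynomials\<close>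

context simplest_cubic_root
begin

text \<open>The symmetric functions of the conjugates are rational algebraic integers, hence
  integers, and form the coefficients of the characteristic polynomial.\<close>

lemma primitive_integerE:
  assumes "x \<in> primitive_integers K"
  obtains x1 x2 T S N where "conjs x x1 x2" "x \<notin> \<rat>"
    "algebraic_int x" "algebraic_int x1" "algebraic_int x2"
    "of_int T = x + x1 + x2" "of_int S = x * x1 + x1 * x2 + x2 * x" "of_int N = x * x1 * x2"
    "int_char_poly K x = [:- N, S, - T, 1:]"
proof -
  have x: "x \<in> K" "algebraic_int x" "x \<notin> \<rat>"
    using assms by (simp_all add: primitive_integers_iff)
  obtain x1 x2 where conj: "conjs x x1 x2" using x(1) K_iff[of x] by blast
  have int: "algebraic_int x1" "algebraic_int x2"
    using conjs_algebraic_int[OF conj x(2)] by simp_all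
  have "x + x1 + x2 \<in> \<int>"
    by (intro rational_algebraic_int_is_int conjs_e1_Rats conj algebraic_int_ring_intros x(2) int)
  then obtain T where T: "of_int T = x + x1 + x2" by (metis Ints_cases)
  have "x * x1 + x1 * x2 + x2 * x \<in> \<int>"
    by (intro rational_algebraic_int_is_int conjs_e2_Rats conj algebraic_int_ring_intros x(2) int)
  then obtain S where S: "of_int S = x * x1 + x1 * x2 + x2 * x" by (metis Ints_cases)
  have "x * x1 * x2 \<in> \<int>"
    by (intro rational_algebraic_int_is_int conjs_e3_Rats conj algebraic_int_ring_intros x(2) int)
  then obtain N where N: "of_int N = x * x1 * x2" by (metis Ints_cases)
  have "x ^ 3 + of_int (- T) * x\<^sup>2 + of_int S * x + of_int (- N) = 0"
    unfolding of_int_minus T S N by Groebner_Basis.algebra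
  then have "int_char_poly K x = [:- N, S, - T, 1:]"
    by (rule int_char_poly_eqI[OF x(1,3)])
  with that[OF conj x(3,2) int T S N] show ?thesis by blast
qed

lemma value_gcd_dvd: "value_gcd K x dvd poly (int_char_poly K x) k"
  unfolding value_gcd_def by (rule Gcd_dvd) simp

lemma value_gcd_dvd_6:
  assumes "x \<in> primitive_integers K"
  shows "value_gcd K x dvd 6"
proof -
  obtain T S N where F: "int_char_poly K x = [:- N, S, - T, 1:]"
    using primitive_integerE[OF assms] by metis
  let ?F = "poly (int_char_poly K x)"
  have "?F 3 - 3 * ?F 2 + 3 * ?F 1 - ?F 0 = 6"
    unfolding F by simp
  moreover have "value_gcd K x dvd ?F 3 - 3 * ?F 2 + 3 * ?F 1 - ?F 0"
    by (intro dvd_add dvd_diff dvd_mult value_gcd_dvd)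
  ultimately show ?thesis by simp
qed

lemma algebraic_int_conjugates: "algebraic_int \<alpha>" "algebraic_int \<alpha>1" "algebraic_int \<alpha>2"
proof -
  have "poly (map_poly of_int [:- 1, - (m + 3), - m, 1:]) \<alpha> = 0"
    using root by (simp add: power2_eq_square power3_eq_cube algebra_simps)
  then show "algebraic_int \<alpha>"
    unfolding algebraic_int_altdef_ipoly by (intro exI[of _ "[:- 1, - (m + 3), - m, 1:]"]) simp
  then show "algebraic_int \<alpha>1" "algebraic_int \<alpha>2"
    using conjs_algebraic_int[OF conjs_\<alpha>] by simp_all
qed

text \<open>The discriminant of \<alpha> multiplies every integer of the field into
  \<int>[\<alpha>]. The same coefficients serve all conjugates.\<close>

lemma disc_mult_integer:
  assumes "conjs x x1 x2" "algebraic_int x"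
  obtains U V W where
    "of_int ((m\<^sup>2 + 3 * m + 9)\<^sup>2) * x = of_int U + of_int V * \<alpha> + of_int W * \<alpha>\<^sup>2"
    "of_int ((m\<^sup>2 + 3 * m + 9)\<^sup>2) * x1 = of_int U + of_int V * \<alpha>1 + of_int W * \<alpha>1\<^sup>2"
    "of_int ((m\<^sup>2 + 3 * m + 9)\<^sup>2) * x2 = of_int U + of_int V * \<alpha>2 + of_int W * \<alpha>2\<^sup>2"
proof -
  obtain u v w where x: "u \<in> \<rat>" "v \<in> \<rat>" "w \<in> \<rat>" "x = u + v * \<alpha> + w * \<alpha>\<^sup>2"
    "x1 = u + v * \<alpha>1 + w * \<alpha>1\<^sup>2" "x2 = u + v * \<alpha>2 + w * \<alpha>2\<^sup>2" using conjsE[OF assms(1)] .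
  define d :: complex where "d = of_int ((m\<^sup>2 + 3 * m + 9)\<^sup>2)"
  have d: "d \<in> \<rat>" unfolding d_def by (rule Rats_of_int)
  have "d * u \<in> \<int> \<and> d * v \<in> \<int> \<and> d * w \<in> \<int>"
    using disc_mult_coeffs_Ints[OF algebraic_int_conjugates assms(2) conjs_algebraic_int[OF assms]
      x(1-3) _ x(4-6)] d unfolding disc_conj d_def[symmetric] by blast
  then obtain U V W where U: "d * u = of_int U" "d * v = of_int V" "d * w = of_int W"
    by (metis Ints_cases)
  have "d * (u + v * t + w * t\<^sup>2) = of_int U + of_int V * t + of_int W * t\<^sup>2" for t
    unfolding U[symmetric] by Groebner_Basis.algebra
  with that show ?thesis unfolding x(4-6) d_def by blast
qed

text \<open>If F(0) and F(1) are even, so are the norms of x and 1 - x. Scaled by the odd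
  discriminant d, both have integer coordinates, all even because 2 is inert; then U and d - U are
  even, against d being odd.\<close>

lemma odd_value_gcd:
  assumes "x \<in> primitive_integers K"
  shows "odd (value_gcd K x)"
proof
  assume even: "even (value_gcd K x)"
  obtain x1 x2 T S N where x: "conjs x x1 x2" "algebraic_int x"
    and TSN: "of_int T = x + x1 + x2" "of_int S = x * x1 + x1 * x2 + x2 * x" "of_int N = x * x1 * x2"
    and F: "int_char_poly K x = [:- N, S, - T, 1:]"
    using primitive_integerE[OF assms] by metis
  have ev: "even (poly (int_char_poly K x) k)" for k
    using even value_gcd_dvd by (rule dvd_trans)
  have evN: "even N" "even (1 - T + S - N)"
    using ev[of 0] ev[of 1] unfolding F by (simp_all add: algebra_simps)
  define d where "d = (m\<^sup>2 + 3 * m + 9)\<^sup>2"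
  have "odd d" unfolding d_def by simp
  obtain U V W where UVW: "of_int d * x = of_int U + of_int V * \<alpha> + of_int W * \<alpha>\<^sup>2"
    "of_int d * x1 = of_int U + of_int V * \<alpha>1 + of_int W * \<alpha>1\<^sup>2"
    "of_int d * x2 = of_int U + of_int V * \<alpha>2 + of_int W * \<alpha>2\<^sup>2"
    using disc_mult_integer[OF x] unfolding d_def .
  have "of_int (d ^ 3 * N) = (of_int d * x) * (of_int d * x1) * (of_int d * x2)"
    unfolding of_int_mult of_int_power TSN by Groebner_Basis.algebra
  also have "\<dots> = of_int (norm_form m U V W)"
    unfolding UVW norm_form_prod[OF conj_e1 conj_e2 conj_e3] norm_form_of_int ..
  finally have "d ^ 3 * N = norm_form m U V W" unfolding of_int_eq_iff .
  with evN(1) have "even U \<and> even V \<and> even W"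
    by (metis even_norm_form_iff even_mult_iff)
  have eq: "of_int d * (1 - x) = of_int (d - U) + of_int (- V) * \<alpha> + of_int (- W) * \<alpha>\<^sup>2"
    "of_int d * (1 - x1) = of_int (d - U) + of_int (- V) * \<alpha>1 + of_int (- W) * \<alpha>1\<^sup>2"
    "of_int d * (1 - x2) = of_int (d - U) + of_int (- V) * \<alpha>2 + of_int (- W) * \<alpha>2\<^sup>2"
    unfolding of_int_diff of_int_minus using UVW by (Groebner_Basis.algebra+)
  have "of_int (d ^ 3 * (1 - T + S - N)) = (of_int d * (1 - x)) * (of_int d * (1 - x1)) * (of_int d * (1 - x2))"
    unfolding of_int_mult of_int_power of_int_add of_int_diff TSN of_int_1 by Groebner_Basis.algebra
  also have "\<dots> = of_int (norm_form m (d - U) (- V) (- W))"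
    unfolding eq norm_form_prod[OF conj_e1 conj_e2 conj_e3] norm_form_of_int ..
  finally have "d ^ 3 * (1 - T + S - N) = norm_form m (d - U) (- V) (- W)" unfolding of_int_eq_iff .
  with evN(2) have "even (d - U)"
    by (metis even_norm_form_iff even_mult_iff)
  with \<open>even U \<and> _\<close> \<open>odd d\<close> show False by simp
qed

text \<open>With e the discriminant of F, the multiple e \<alpha> is a polynomial y in x with
  integer coefficients. A root r of F mod 81 then turns y into a root mod 81 of the simplest cubic
  scaled by e.\<close>

lemma three_dvd_value_gcd_imp:
  assumes prim: "x \<in> primitive_integers K" and 3: "3 dvd value_gcd K x"
  shows "81 dvd m - 39"
proof -
  obtain x1 x2 T S N where x: "conjs x x1 x2" "x \<notin> \<rat>"
    and int: "algebraic_int x" "algebraic_int x1" "algebraic_int x2"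
    and TSN: "of_int T = x + x1 + x2" "of_int S = x * x1 + x1 * x2 + x2 * x" "of_int N = x * x1 * x2"
    and F: "int_char_poly K x = [:- N, S, - T, 1:]"
    using primitive_integerE[OF prim] by metis
  have dvd: "3 dvd poly (int_char_poly K x) k" for k
    using 3 value_gcd_dvd by (rule dvd_trans)
  \<comment> \<open>Divisibility of the values at 0, 1 and - 1 fixes F mod 3 as x^3 - x.\<close>
  have "3 dvd N" "3 dvd 1 - T + S - N" "3 dvd - 1 - T - S - N"
    using dvd[of 0] dvd[of 1] dvd[of "- 1"] unfolding F by (simp_all add: algebra_simps)
  then have mod3: "3 dvd N" "3 dvd T" "3 dvd S + 1" by presburger+
  define e where "e = T\<^sup>2 * S\<^sup>2 - 4 * S ^ 3 - 4 * T ^ 3 * N + 18 * T * S * N - 27 * N\<^sup>2"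
  have disc: "((x - x1) * (x1 - x2) * (x2 - x))\<^sup>2 = of_int e"
    unfolding disc_cubic e_def TSN[symmetric] by simp
  have e3: "\<not> 3 dvd e"
  proof -
    obtain t s n where eq: "T = 3 * t" "S = 3 * s - 1" "N = 3 * n"
      using mod3 unfolding dvd_def by (metis add_diff_cancel)
    \<comment> \<open>The discriminant of x^3 - x is 4, which is 1 mod 3.\<close>
    have "e = 3 * (3 * t\<^sup>2 * S\<^sup>2 - 36 * s ^ 3 + 36 * s\<^sup>2 - 12 * s + 1 - 4 * 9 * t ^ 3 * N + 6 * T * S * N - 9 * N\<^sup>2) + 1"
      unfolding e_def eq by Groebner_Basis.algebra
    moreover have "\<not> 3 dvd 3 * n + 1" for n :: int by presburger
    ultimately show ?thesis by (simp only: not_False_eq_True)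
  qed
  obtain u v w where uvw: "u \<in> \<rat>" "v \<in> \<rat>" "w \<in> \<rat>" "\<alpha> = u + v * x + w * x\<^sup>2"
    "\<alpha>1 = u + v * x1 + w * x1\<^sup>2" "\<alpha>2 = u + v * x2 + w * x2\<^sup>2"
    using conjs_generator[OF x] .
  have "of_int e * u \<in> \<int> \<and> of_int e * v \<in> \<int> \<and> of_int e * w \<in> \<int>"
    using disc_mult_coeffs_Ints[OF int algebraic_int_conjugates uvw(1-3) _ uvw(4-6)]
      Rats_of_int[of e] unfolding disc by blast
  then obtain U V W where UVW: "of_int e * u = of_int U" "of_int e * v = of_int V" "of_int e * w = of_int W"
    by (metis Ints_cases)
  have e\<alpha>: "of_int e * \<alpha> = of_int U + of_int V * x + of_int W * x\<^sup>2"
    unfolding UVW[symmetric] by (subst uvw(4)) Groebner_Basis.algebra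
  define y where "y = [:U, V, W:]"
  \<comment> \<open>At x this polynomial equals e^3 times the simplest cubic at \<alpha>, hence 0,
    so its remainder modulo F is 0 and F(r) divides \<open>poly p r\<close>.\<close>
  define p where "p = y ^ 3 - [:m * e:] * y\<^sup>2 - [:(m + 3) * e\<^sup>2:] * y - [:e ^ 3:]"
  obtain r where r: "3 ^ Suc 3 dvd r ^ 3 - T * r\<^sup>2 + S * r - N"
    using cubic_root_mod_power_3[OF mod3(2,3,1)] by blast
  have "x ^ 3 = of_int T * x\<^sup>2 - of_int S * x + of_int N"
    unfolding TSN by Groebner_Basis.algebra
  from int_poly_reduce_cubic[OF this, of p r]
  obtain A B C where ABC: "poly (map_poly of_int p) x = of_int A + of_int B * x + of_int C * x\<^sup>2"
    "(r ^ 3 - T * r\<^sup>2 + S * r - N) dvd poly p r - (A + B * r + C * r\<^sup>2)" by blast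
  have yx: "poly (map_poly of_int y) x = of_int e * \<alpha>"
    unfolding e\<alpha> y_def by (simp add: of_int_hom.map_poly_pCons_hom algebra_simps power2_eq_square)
  have "poly (map_poly of_int p) x = (of_int e * \<alpha>) ^ 3 - of_int (m * e) * (of_int e * \<alpha>)\<^sup>2
      - of_int ((m + 3) * e\<^sup>2) * (of_int e * \<alpha>) - of_int (e ^ 3)"
    unfolding p_def by (simp add: of_int_hom.map_poly_pCons_hom of_int_hom.map_poly_hom_smult of_int_poly_hom.hom_minus of_int_poly_hom.hom_mult of_int_poly_hom.hom_power yx)
  also have "\<dots> = of_int e ^ 3 * (\<alpha> ^ 3 - (of_int m * \<alpha>\<^sup>2 + (of_int m + 3) * \<alpha> + 1))"
    unfolding of_int_mult of_int_power of_int_add of_int_numeral by Groebner_Basis.algebra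
  also have "\<dots> = 0" using root by simp
  finally have "of_int A + of_int B * x + of_int C * x\<^sup>2 = 0"
    unfolding ABC(1) .
  then have "of_int A = (0 :: complex) \<and> of_int B = (0 :: complex) \<and> of_int C = (0 :: complex)"
    by (intro conjs_independent[OF x]) simp_all
  with ABC(2) have "(r ^ 3 - T * r\<^sup>2 + S * r - N) dvd poly p r" by simp
  with r have "3 ^ Suc 3 dvd poly p r" by (rule dvd_trans)
  then have "81 dvd (poly y r) ^ 3 - m * e * (poly y r)\<^sup>2 - (m + 3) * e\<^sup>2 * poly y r - e ^ 3"
    unfolding p_def by simp
  from simplest_cubic_scaled_root_mod_81[OF this e3] show ?thesis .
qed

lemma three_dvd_value_gcd_witness:
  assumes "81 dvd m - 39"
  shows "\<exists>x\<in>primitive_integers K. 3 dvd value_gcd K x"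
proof -
  obtain k where k: "m = 39 + 81 * k"
    using assms by (metis add.commute diff_add_cancel dvdE)
  \<comment> \<open>For these m, 1 is a root of the simplest cubic mod 81. Substituting 3 x + 1 and
    dividing by 27 leaves a monic integer cubic that is x^3 - x mod 3.\<close>
  define x where "x = (\<alpha> - 1) / 3"
  have \<alpha>: "\<alpha> = 3 * x + 1" by (simp add: x_def)
  have xK: "x \<in> K"
    unfolding K_basis_iff x_def
    by (intro bexI[of _ "- 1 / 3"] bexI[of _ "1 / 3"] bexI[of _ 0]) (simp_all add: diff_divide_distrib)
  have xQ: "x \<notin> \<rat>"
    using \<alpha>_notin_Rats unfolding \<alpha> by auto
  \<comment> \<open>A free complex variable takes the place of the image of k, so that this is a
    polynomial identity.\<close>
  have "27 * (x ^ 3 + - (12 + 27 * \<kappa>) * x\<^sup>2 + - (13 + 27 * \<kappa>) * x + - (3 + 6 * \<kappa>)) =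
      (3 * x + 1) ^ 3 - ((39 + 81 * \<kappa>) * (3 * x + 1)\<^sup>2 + (39 + 81 * \<kappa> + 3) * (3 * x + 1) + 1)" for \<kappa>
    by Groebner_Basis.algebra
  also have "(3 * x + 1) ^ 3 - ((39 + 81 * of_int k) * (3 * x + 1)\<^sup>2 + (39 + 81 * of_int k + 3) * (3 * x + 1) + 1) = 0"
    using root unfolding \<alpha> k by simp
  finally have "x ^ 3 + - (12 + 27 * of_int k) * x\<^sup>2 + - (13 + 27 * of_int k) * x
      + - (3 + 6 * of_int k) = 0"
    unfolding mult_eq_0_iff by (elim disjE) (simp, assumption)
  then have eq: "x ^ 3 + of_int (- (12 + 27 * k)) * x\<^sup>2 + of_int (- (13 + 27 * k)) * x + of_int (- (3 + 6 * k)) = 0"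
    unfolding of_int_minus of_int_add of_int_mult of_int_numeral .
  from int_char_poly_eqI[OF xK xQ eq]
  have F: "int_char_poly K x = [:- (3 + 6 * k), - (13 + 27 * k), - (12 + 27 * k), 1:]" .
  have "poly (map_poly of_int [:- (3 + 6 * k), - (13 + 27 * k), - (12 + 27 * k), 1:]) x =
      x ^ 3 + of_int (- (12 + 27 * k)) * x\<^sup>2 + of_int (- (13 + 27 * k)) * x + of_int (- (3 + 6 * k))"
    by (simp only: of_int_hom.map_poly_pCons_hom poly_pCons map_poly_0 poly_0 of_int_1)
      Groebner_Basis.algebra
  with eq have "algebraic_int x"
    unfolding algebraic_int_altdef_ipoly
    by (intro exI[of _ "[:- (3 + 6 * k), - (13 + 27 * k), - (12 + 27 * k), 1:]"]) simp
  with xK xQ have "x \<in> primitive_integers K"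
    by (simp add: primitive_integers_iff)
  moreover have "3 dvd value_gcd K x"
    unfolding value_gcd_def
  proof (rule Gcd_greatest)
    fix b assume "b \<in> range (poly (int_char_poly K x))"
    then obtain z where b: "b = poly (int_char_poly K x) z" by blast
    have "z mod 3 = 0 \<or> z mod 3 = 1 \<or> z mod 3 = 2" by presburger
    then have "z ^ 3 mod 3 = z mod 3"
      by (elim disjE) (simp_all flip: power_mod[of z 3])
    then have "3 dvd z ^ 3 - z" by (simp add: mod_eq_dvd_iff)
    moreover have "b = (z ^ 3 - z) - 3 * ((4 + 9 * k) * z\<^sup>2 + (4 + 9 * k) * z + 1 + 2 * k)"
      unfolding b F by (simp add: algebra_simps power2_eq_square power3_eq_cube)
    ultimately show "3 dvd b" by simp
  qed
  ultimately show ?thesis by blast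
qed

lemma value_lcm_K:
  "value_lcm K = (if 81 dvd m - 39 then 3 else 1)"
proof -
  have val: "value_gcd K x = 1 \<or> value_gcd K x = 3" if "x \<in> primitive_integers K" for x
  proof -
    have "value_gcd K x \<ge> 0" by (simp add: value_gcd_def)
    moreover have "value_gcd K x \<le> 6"
      using value_gcd_dvd_6[OF that] by (rule zdvd_imp_le) simp
    ultimately have "value_gcd K x \<in> {0, 1, 2, 3, 4, 5, 6}" by auto
    then show ?thesis
      using value_gcd_dvd_6[OF that] odd_value_gcd[OF that] by auto
  qed
  show ?thesis
  proof (cases "81 dvd m - 39")
    case True
    then obtain x where "x \<in> primitive_integers K" "3 dvd value_gcd K x"
      using three_dvd_value_gcd_witness by blast
    moreover from this have "value_gcd K x = 3" using val[of x] by auto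
    ultimately have "3 \<in> value_gcd K ` primitive_integers K" by (metis imageI)
    moreover have "value_gcd K ` primitive_integers K \<subseteq> {1, 3}" using val by auto
    ultimately have "value_gcd K ` primitive_integers K = {3} \<or> value_gcd K ` primitive_integers K = {1, 3}"
      by auto
    then have "value_lcm K = 3" unfolding value_lcm_def by (elim disjE) simp_all
    with True show ?thesis by simp
  next
    case False
    then have "value_gcd K x = 1" if "x \<in> primitive_integers K" for x
      using val[OF that] three_dvd_value_gcd_imp[OF that] by auto
    then have "value_gcd K ` primitive_integers K \<subseteq> {1}" by blast
    then have "value_gcd K ` primitive_integers K = {} \<or> value_gcd K ` primitive_integers K = {1}"
      unfolding subset_singleton_iff .
    then have "value_lcm K = 1" unfolding value_lcm_def by (elim disjE) simp_all
    with False show ?thesis by simp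
  qed
qed

end

section \<open>Additive indices, subgroups of \<int> and the ring \<int>[\<eta>]\<close>

lemma additive_comm_group:
  fixes A :: "complex set"
  assumes "0 \<in> A" "\<And>x y. x \<in> A \<Longrightarrow> y \<in> A \<Longrightarrow> x + y \<in> A" "\<And>x. x \<in> A \<Longrightarrow> - x \<in> A"
  shows "comm_group (add_monoid (ring_of_type_algebra\<lparr>carrier := A\<rparr>))"
proof (rule comm_groupI)
  fix x assume "x \<in> carrier (add_monoid (ring_of_type_algebra\<lparr>carrier := A\<rparr>))"
  then show "\<exists>y\<in>carrier (add_monoid (ring_of_type_algebra\<lparr>carrier := A\<rparr>)).
      y \<otimes>\<^bsub>add_monoid (ring_of_type_algebra\<lparr>carrier := A\<rparr>)\<^esub> x
      = \<one>\<^bsub>add_monoid (ring_of_type_algebra\<lparr>carrier := A\<rparr>)\<^esub>"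
    using assms(3) by (intro bexI[of _ "- x"]) (simp_all add: ring_of_type_algebra_def)
qed (use assms in \<open>simp_all add: ring_of_type_algebra_def add_ac\<close>)

text \<open>The additive form of \<open>prime_not_dvd_index\<close>. The set \<open>R\<close> meets
  every coset and so makes the index finite; an infinite set of cosets would have
  \<open>card\<close> 0, a multiple of p.\<close>

lemma prime_not_dvd_additive_index:
  fixes A H :: "complex set" and p N :: nat
  assumes A: "0 \<in> A" "\<And>x y. x \<in> A \<Longrightarrow> y \<in> A \<Longrightarrow> x + y \<in> A" "\<And>x. x \<in> A \<Longrightarrow> - x \<in> A"
    and H: "H \<subseteq> A" "0 \<in> H" "\<And>x y. x \<in> H \<Longrightarrow> y \<in> H \<Longrightarrow> x + y \<in> H" "\<And>x. x \<in> H \<Longrightarrow> - x \<in> H"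
    and R: "finite R" "\<And>x. x \<in> A \<Longrightarrow> \<exists>r\<in>R. x - r \<in> H"
    and p: "Factorial_Ring.prime p" "\<not> p dvd N" and N: "\<And>x. x \<in> A \<Longrightarrow> of_nat N * x \<in> H"
  shows "\<not> p dvd card (a_rcosets\<^bsub>ring_of_type_algebra\<lparr>carrier := A\<rparr>\<^esub> H)"
proof -
  define G where "G = add_monoid (ring_of_type_algebra\<lparr>carrier := A\<rparr>)"
  have G: "carrier G = A" "\<And>x y. x \<otimes>\<^bsub>G\<^esub> y = x + y" "\<one>\<^bsub>G\<^esub> = 0"
    by (simp_all add: G_def ring_of_type_algebra_def)
  interpret G: comm_group G
    unfolding G_def by (rule additive_comm_group[OF A])
  have inv: "inv\<^bsub>G\<^esub> x = - x" if "x \<in> A" for x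
    by (rule G.inv_equality) (use that A in \<open>simp_all add: G\<close>)
  have sub: "subgroup H G"
    by (rule G.subgroupI) (use H inv in \<open>auto simp: G\<close>)
  have pow: "x [^]\<^bsub>G\<^esub> n = of_nat n * x" for x and n :: nat
    by (induction n) (simp_all add: G algebra_simps)
  have coset: "H #>\<^bsub>G\<^esub> x = {h. h - x \<in> H}" for x
  proof
    show "H #>\<^bsub>G\<^esub> x \<subseteq> {h. h - x \<in> H}"
      by (auto simp: r_coset_def G)
    show "{h. h - x \<in> H} \<subseteq> H #>\<^bsub>G\<^esub> x"
    proof
      fix h assume "h \<in> {h. h - x \<in> H}"
      then have "h - x \<in> H" "h = (h - x) + x" by simp_all
      then show "h \<in> H #>\<^bsub>G\<^esub> x"
        unfolding r_coset_def G by blast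
    qed
  qed
  have "rcosets\<^bsub>G\<^esub> H \<subseteq> (\<lambda>r. H #>\<^bsub>G\<^esub> r) ` R"
  proof
    fix C assume "C \<in> rcosets\<^bsub>G\<^esub> H"
    then obtain x where x: "x \<in> A" "C = H #>\<^bsub>G\<^esub> x"
      unfolding RCOSETS_def G by blast
    obtain r where r: "r \<in> R" "x - r \<in> H" using R(2)[OF x(1)] by blast
    have "h - x \<in> H \<longleftrightarrow> h - r \<in> H" for h
    proof
      assume "h - x \<in> H"
      from H(3)[OF this r(2)] show "h - r \<in> H" by simp
    next
      assume "h - r \<in> H"
      from H(3)[OF this H(4)[OF r(2)]] show "h - x \<in> H" by simp
    qed
    then have "C = H #>\<^bsub>G\<^esub> r" unfolding x(2) coset by simp
    with r(1) show "C \<in> (\<lambda>r. H #>\<^bsub>G\<^esub> r) ` R" by blast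
  qed
  then have "finite (rcosets\<^bsub>G\<^esub> H)"
    using R(1) by (meson finite_imageI finite_subset)
  from G.prime_not_dvd_index[OF sub this p(1) _ p(2)] show ?thesis
    unfolding A_RCOSETS_def G_def[symmetric] pow G(1) using N by blast
qed

text \<open>Compares \<open>(w * w) * t\<close> with \<open>w * (w * t)\<close>.\<close>

lemma cubic_basis_assoc:
  fixes w t N q b a l d c :: complex
  assumes "w * t = N" "w\<^sup>2 = q + b * w + a * t" "t\<^sup>2 = l + d * w + c * t"
  shows "(b * N + a * l) + (a * d - N) * w + (q + a * c) * t = 0"
proof -
  have "w\<^sup>2 * t = w * (w * t)" by (simp add: power2_eq_square)
  then show ?thesis using assms by Groebner_Basis.algebra
qed

text \<open>The least positive element divides all others, since closure under s - k * t keeps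
  remainders in the set.\<close>

lemma int_subgroup_generator:
  fixes S :: "int set"
  assumes "s \<in> S" "s > 0" and closed: "\<And>s t k. s \<in> S \<Longrightarrow> t \<in> S \<Longrightarrow> s - k * t \<in> S"
  obtains g where "g > 0" "g \<in> S" "\<And>t. t \<in> S \<Longrightarrow> g dvd t"
proof -
  define n where "n = (LEAST n. n > 0 \<and> int n \<in> S)"
  have n: "n > 0 \<and> int n \<in> S"
    unfolding n_def by (rule LeastI[of _ "nat s"]) (use assms in simp)
  have "int n dvd t" if "t \<in> S" for t
  proof -
    have "t mod int n = t - (t div int n) * int n" by (simp add: minus_div_mult_eq_mod)
    then have "t mod int n \<in> S" using closed[OF that, of "int n" "t div int n"] n by simp
    then have mem: "int (nat (t mod int n)) \<in> S" using n by simp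
    have lt: "nat (t mod int n) < n" using n by (simp add: nat_less_iff)
    have "\<not> (nat (t mod int n) > 0 \<and> int (nat (t mod int n)) \<in> S)"
      using lt unfolding n_def by (rule not_less_Least)
    with mem have "\<not> nat (t mod int n) > 0" by (simp only: simp_thms)
    then have "t mod int n = 0" using n by (simp add: dual_order.antisym)
    then show ?thesis by presburger
  qed
  with n that[of "int n"] show ?thesis by simp
qed

lemma int_adjoin_of_int: "of_int k \<in> int_adjoin \<eta>"
  unfolding int_adjoin_def by (rule range_eqI[of _ _ "[:k:]"]) (simp add: of_int_hom.map_poly_pCons_hom)

lemma int_adjoin_incl: "\<eta> \<in> int_adjoin \<eta>"
  unfolding int_adjoin_def by (rule range_eqI[of _ _ "[:0, 1:]"]) (simp add: of_int_hom.map_poly_pCons_hom)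

lemma int_adjoin_add: "x \<in> int_adjoin \<eta> \<Longrightarrow> y \<in> int_adjoin \<eta> \<Longrightarrow> x + y \<in> int_adjoin \<eta>"
  unfolding int_adjoin_def
proof (elim rangeE)
  fix p q :: "int poly"
  assume "x = poly (map_poly of_int p) \<eta>" "y = poly (map_poly of_int q) \<eta>"
  then show "x + y \<in> range (\<lambda>p. poly (map_poly of_int p) \<eta>)"
    by (intro range_eqI[of _ _ "p + q"]) (simp add: of_int_poly_hom.hom_add)
qed

lemma int_adjoin_mult: "x \<in> int_adjoin \<eta> \<Longrightarrow> y \<in> int_adjoin \<eta> \<Longrightarrow> x * y \<in> int_adjoin \<eta>"
  unfolding int_adjoin_def
proof (elim rangeE)
  fix p q :: "int poly"
  assume "x = poly (map_poly of_int p) \<eta>" "y = poly (map_poly of_int q) \<eta>"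
  then show "x * y \<in> range (\<lambda>p. poly (map_poly of_int p) \<eta>)"
    by (intro range_eqI[of _ _ "p * q"]) (simp add: of_int_poly_hom.hom_mult)
qed

lemma int_adjoin_diff:
  assumes "x \<in> int_adjoin \<eta>" "y \<in> int_adjoin \<eta>"
  shows "x - y \<in> int_adjoin \<eta>"
  using int_adjoin_add[OF assms(1) int_adjoin_mult[OF int_adjoin_of_int[of "- 1"] assms(2)]] by simp

lemma int_adjoin_subset:
  assumes "\<eta> \<in> S" "\<And>k. of_int k \<in> S" "\<And>x y. x \<in> S \<Longrightarrow> y \<in> S \<Longrightarrow> x + y \<in> S"
    "\<And>x y. x \<in> S \<Longrightarrow> y \<in> S \<Longrightarrow> x * y \<in> S"
  shows "int_adjoin \<eta> \<subseteq> S"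
proof -
  have "poly (map_poly of_int p) \<eta> \<in> S" for p
  proof (induction p)
    case 0
    then show ?case using assms(2)[of 0] by simp
  next
    case (pCons a p)
    have "poly (map_poly of_int (pCons a p)) \<eta> = of_int a + \<eta> * poly (map_poly of_int p) \<eta>"
      by (simp add: of_int_hom.map_poly_pCons_hom)
    then show ?case using assms pCons.IH by simp
  qed
  then show ?thesis unfolding int_adjoin_def by blast
qed

section \<open>Integral bases and the index form\<close>

context simplest_cubic_root
begin

abbreviation A :: "complex set" where "A \<equiv> ring_of_integers K"

lemma A_iff: "x \<in> A \<longleftrightarrow> x \<in> K \<and> algebraic_int x"
  by (simp add: ring_of_integers_def)

lemma A_add: "x \<in> A \<Longrightarrow> y \<in> A \<Longrightarrow> x + y \<in> A"
  unfolding A_iff by (blast intro: rat_adjoin_add algebraic_int_add)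

lemma A_mult: "x \<in> A \<Longrightarrow> y \<in> A \<Longrightarrow> x * y \<in> A"
  unfolding A_iff by (blast intro: rat_adjoin_mult algebraic_int_mult)

lemma A_of_int: "of_int k \<in> A"
  unfolding A_iff by (simp add: rat_adjoin_of_int)

lemma A_diff: "x \<in> A \<Longrightarrow> y \<in> A \<Longrightarrow> x - y \<in> A"
  using A_add[of x "- 1 * y"] A_mult[OF A_of_int[of "- 1"]] by simp

lemma A_\<alpha>: "\<alpha> \<in> A"
  unfolding A_iff using rat_adjoin_incl algebraic_int_conjugates by blast

lemma A_Rats: "x \<in> A \<Longrightarrow> x \<in> \<rat> \<Longrightarrow> \<exists>k. x = of_int k"
  unfolding A_iff using rational_algebraic_int_is_int by (metis Ints_cases)

definition integral_basis :: "complex \<Rightarrow> complex \<Rightarrow> bool" where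
  "integral_basis \<omega> \<theta> \<longleftrightarrow> \<omega> \<in> A \<and> \<theta> \<in> A \<and>
     (\<forall>x\<in>A. \<exists>k i j. x = of_int k + of_int i * \<omega> + of_int j * \<theta>) \<and>
     (\<forall>k i j. of_int k + of_int i * \<omega> + of_int j * \<theta> = 0 \<longrightarrow> k = 0 \<and> i = 0 \<and> j = 0)"

text \<open>Triangular reduction inside \<int>[\<alpha>] after scaling by the discriminant: \<theta>
  has the least positive coefficient at \<alpha>^2, and \<omega> the least positive coefficient at
  \<alpha> among integers without \<alpha>^2. What then remains is a rational integer.\<close>

lemma integral_basis_exists: "\<exists>\<omega> \<theta>. integral_basis \<omega> \<theta>"
proof -
  define d where "d = (m\<^sup>2 + 3 * m + 9)\<^sup>2"
  have "m\<^sup>2 + 3 * m + 9 \<noteq> 0" using odd_disc by (metis even_zero)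
  then have d: "d > 0" unfolding d_def by (rule zero_less_power2[THEN iffD2])
  define P where "P = (\<lambda>x U V W. x \<in> A \<and> of_int d * x = of_int U + of_int V * \<alpha> + of_int W * \<alpha>\<^sup>2)"
  have PI: "\<exists>U V W. P x U V W" if x: "x \<in> A" for x
  proof -
    obtain x1 x2 where "conjs x x1 x2" using x K_iff[of x] unfolding A_iff by blast
    with x show ?thesis
      using disc_mult_integer[of x x1 x2] unfolding P_def d_def A_iff by metis
  qed
  have P_diff: "P (x - of_int k * x') (U - k * U') (V - k * V') (W - k * W')"
    if "P x U V W" "P x' U' V' W'" for x U V W x' U' V' W' k
  proof -
    have "x - of_int k * x' \<in> A"
      using that unfolding P_def by (blast intro: A_diff A_mult A_of_int)
    moreover have "of_int d * (x - of_int k * x') =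
        of_int (U - k * U') + of_int (V - k * V') * \<alpha> + of_int (W - k * W') * \<alpha>\<^sup>2"
      using that unfolding P_def of_int_diff of_int_mult by Groebner_Basis.algebra
    ultimately show ?thesis unfolding P_def by blast
  qed
  \<comment> \<open>The squares and multiples of \<alpha> itself supply a positive element for each
    of the two coefficient groups.\<close>
  have "P (\<alpha>\<^sup>2) 0 0 d" unfolding P_def power2_eq_square using A_mult[OF A_\<alpha> A_\<alpha>] by simp
  define Ws where "Ws = {W. \<exists>x U V. P x U V W}"
  have dWs: "d \<in> Ws" using \<open>P (\<alpha>\<^sup>2) 0 0 d\<close> unfolding Ws_def by blast
  have Ws: "s - k * t \<in> Ws" if st: "s \<in> Ws" "t \<in> Ws" for s t k
    using st P_diff unfolding Ws_def by blast
  obtain g where g: "g > 0" "g \<in> Ws" "\<And>W. W \<in> Ws \<Longrightarrow> g dvd W"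
    using int_subgroup_generator[OF dWs d Ws] by metis
  then obtain \<theta> Ut Vt where \<theta>: "P \<theta> Ut Vt g" unfolding Ws_def by blast
  define Vs where "Vs = {V. \<exists>x U. P x U V 0}"
  have "P \<alpha> 0 d 0" unfolding P_def using A_\<alpha> by simp
  then have dVs: "d \<in> Vs" unfolding Vs_def by blast
  have Vs: "s - k * t \<in> Vs" if st: "s \<in> Vs" "t \<in> Vs" for s t k
  proof -
    obtain x U x' U' where "P x U s 0" "P x' U' t 0" using st unfolding Vs_def by blast
    from P_diff[OF this, of k] show ?thesis unfolding Vs_def by auto
  qed
  obtain h where h: "h > 0" "h \<in> Vs" "\<And>V. V \<in> Vs \<Longrightarrow> h dvd V"
    using int_subgroup_generator[OF dVs d Vs] by metis
  then obtain \<omega> Uo where \<omega>: "P \<omega> Uo h 0" unfolding Vs_def by blast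
  have "\<exists>k i j. x = of_int k + of_int i * \<omega> + of_int j * \<theta>" if xA: "x \<in> A" for x
  proof -
    obtain U V W where x: "P x U V W" using PI[OF xA] by blast
    then have "g dvd W" by (intro g(3)) (unfold Ws_def, blast)
    then obtain j where j: "W = j * g" by (metis dvdE mult.commute)
    have "P (x - of_int j * \<theta>) (U - j * Ut) (V - j * Vt) 0"
      using P_diff[OF x \<theta>, of j] j by simp
    moreover from this have "h dvd V - j * Vt" by (intro h(3)) (unfold Vs_def, blast)
    then obtain i where i: "V - j * Vt = i * h" by (metis dvdE mult.commute)
    ultimately have y: "P (x - of_int j * \<theta> - of_int i * \<omega>) (U - j * Ut - i * Uo) 0 0"
      using P_diff[OF _ \<omega>, of "x - of_int j * \<theta>" "U - j * Ut" "V - j * Vt" 0 i] by simp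
    then have "of_int d * (x - of_int j * \<theta> - of_int i * \<omega>) = of_int (U - j * Ut - i * Uo)"
      unfolding P_def by simp
    then have "x - of_int j * \<theta> - of_int i * \<omega> = of_int (U - j * Ut - i * Uo) / of_int d"
      using d by (metis nonzero_mult_div_cancel_left of_int_eq_0_iff less_irrefl)
    then have "x - of_int j * \<theta> - of_int i * \<omega> \<in> \<rat>" by simp
    with y obtain k where "x - of_int j * \<theta> - of_int i * \<omega> = of_int k"
      using A_Rats unfolding P_def by blast
    then have "x = of_int k + of_int i * \<omega> + of_int j * \<theta>" by (simp add: diff_eq_eq add_ac)
    then show ?thesis by blast
  qed
  moreover have "k = 0 \<and> i = 0 \<and> j = 0"
    if eq: "of_int k + of_int i * \<omega> + of_int j * \<theta> = 0" for k i j
  proof -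
    \<comment> \<open>Rewritten over the powers of \<alpha>, the relation becomes triangular with
      nonzero diagonal d, h, g.\<close>
    have "of_int (d * k + i * Uo + j * Ut) + of_int (i * h + j * Vt) * \<alpha> + of_int (j * g) * \<alpha>\<^sup>2 = 0"
      using eq \<omega> \<theta> unfolding P_def of_int_add of_int_mult of_int_0 by Groebner_Basis.algebra
    then have "of_int (d * k + i * Uo + j * Ut) = (0 :: complex) \<and>
        of_int (i * h + j * Vt) = (0 :: complex) \<and> of_int (j * g) = (0 :: complex)"
      by (intro independent Rats_of_int)
    then have "d * k + i * Uo + j * Ut = 0" "i * h + j * Vt = 0" "j * g = 0"
      unfolding of_int_eq_0_iff by blast+
    then show ?thesis using d g(1) h(1) by simp
  qed
  ultimately have "integral_basis \<omega> \<theta>"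
    unfolding integral_basis_def using \<omega> \<theta> unfolding P_def by blast
  then show ?thesis by blast
qed

text \<open>Translating \<omega> by v and \<theta> by u cancels the linear terms u \<omega> + v
  \<theta> of their product.\<close>

lemma integral_basis_normalized:
  obtains \<omega> \<theta> n where "integral_basis \<omega> \<theta>" "\<omega> * \<theta> = of_int n"
proof -
  obtain \<omega> \<theta> where b: "integral_basis \<omega> \<theta>" using integral_basis_exists by blast
  then have A: "\<omega> \<in> A" "\<theta> \<in> A"
    and gen: "\<And>x. x \<in> A \<Longrightarrow> \<exists>k i j. x = of_int k + of_int i * \<omega> + of_int j * \<theta>"
    and ind: "\<And>k i j. of_int k + of_int i * \<omega> + of_int j * \<theta> = 0 \<Longrightarrow> k = 0 \<and> i = 0 \<and> j = 0"
    unfolding integral_basis_def by blast+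
  obtain n u v where n: "\<omega> * \<theta> = of_int n + of_int u * \<omega> + of_int v * \<theta>"
    using gen[OF A_mult[OF A]] by blast
  have "integral_basis (\<omega> - of_int v) (\<theta> - of_int u)"
    unfolding integral_basis_def
  proof (intro conjI ballI allI impI)
    show "\<omega> - of_int v \<in> A" "\<theta> - of_int u \<in> A"
      by (intro A_diff A A_of_int)+
  next
    fix x assume "x \<in> A"
    then obtain k i j where "x = of_int k + of_int i * \<omega> + of_int j * \<theta>" using gen by blast
    then have "x = of_int (k + i * v + j * u) + of_int i * (\<omega> - of_int v) + of_int j * (\<theta> - of_int u)"
      unfolding of_int_add of_int_mult by Groebner_Basis.algebra
    then show "\<exists>k i j. x = of_int k + of_int i * (\<omega> - of_int v) + of_int j * (\<theta> - of_int u)" by blast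
  next
    fix k i j assume "of_int k + of_int i * (\<omega> - of_int v) + of_int j * (\<theta> - of_int u) = 0"
    then have "of_int (k - i * v - j * u) + of_int i * \<omega> + of_int j * \<theta> = 0"
      unfolding of_int_diff of_int_mult by Groebner_Basis.algebra
    from ind[OF this] show "k = 0" "i = 0" "j = 0" by auto
  qed
  moreover have "(\<omega> - of_int v) * (\<theta> - of_int u) = of_int (n + u * v)"
    using n unfolding of_int_add of_int_mult by Groebner_Basis.algebra
  ultimately show ?thesis using that by blast
qed

text \<open>It bounds the primes of an index by an annihilator N of the quotient, which avoids
  computing the index itself.\<close>

lemma element_index_not_dvd:
  assumes p: "Factorial_Ring.prime (p :: nat)" and \<eta>: "\<eta> \<in> A"
    and N: "\<And>x. x \<in> A \<Longrightarrow> of_int N * x \<in> int_adjoin \<eta>" and pN: "\<not> int p dvd N"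
  shows "\<not> p dvd element_index K \<eta>"
proof -
  obtain \<omega> \<theta> where "integral_basis \<omega> \<theta>" using integral_basis_exists by blast
  then have A: "\<omega> \<in> A" "\<theta> \<in> A"
    and gen: "\<And>x. x \<in> A \<Longrightarrow> \<exists>k i j. x = of_int k + of_int i * \<omega> + of_int j * \<theta>"
    unfolding integral_basis_def by blast+
  define M where "M = nat \<bar>N\<bar>"
  have "N \<noteq> 0" using pN by auto
  then have M: "M > 0" "int M = N \<or> int M = - N" by (auto simp: M_def)
  have minus: "- x \<in> int_adjoin \<eta>" if "x \<in> int_adjoin \<eta>" for x
    using int_adjoin_diff[OF int_adjoin_of_int[of 0] that] by simp
  have MA: "of_int (int M) * x \<in> int_adjoin \<eta>" if "x \<in> A" for x
    using M(2) N[OF that] minus[OF N[OF that]] by (elim disjE) simp_all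
  \<comment> \<open>Coordinates reduced modulo the annihilator represent all cosets; the coordinate
    at 1 already lies in \<int>[\<eta>].\<close>
  define R where "R = (\<lambda>(i, j). of_int i * \<omega> + of_int j * \<theta>) ` ({0..<int M} \<times> {0..<int M})"
  show ?thesis
    unfolding element_index_def
  proof (rule prime_not_dvd_additive_index[of A "int_adjoin \<eta>" R p M])
    show "\<exists>r\<in>R. x - r \<in> int_adjoin \<eta>" if x: "x \<in> A" for x
    proof -
      obtain k i j where kij: "x = of_int k + of_int i * \<omega> + of_int j * \<theta>" using gen[OF x] by blast
      define r where "r = of_int (i mod int M) * \<omega> + of_int (j mod int M) * \<theta>"
      have "r \<in> R" using M(1) unfolding R_def r_def by force
      have "of_int i = (of_int (int M) * of_int (i div int M) + of_int (i mod int M) :: complex)"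
        "of_int j = (of_int (int M) * of_int (j div int M) + of_int (j mod int M) :: complex)"
        unfolding of_int_mult[symmetric] of_int_add[symmetric] by simp_all
      then have "x - r = of_int k + (of_int (i div int M) * (of_int (int M) * \<omega>)
          + of_int (j div int M) * (of_int (int M) * \<theta>))"
        unfolding kij r_def by Groebner_Basis.algebra
      also have "\<dots> \<in> int_adjoin \<eta>"
        by (intro int_adjoin_add int_adjoin_mult[OF int_adjoin_of_int] int_adjoin_of_int MA A)
      finally show ?thesis using \<open>r \<in> R\<close> by blast
    qed
    show "int_adjoin \<eta> \<subseteq> A"
      using \<eta> A_add A_mult A_of_int by (intro int_adjoin_subset)
    show "of_nat M * x \<in> int_adjoin \<eta>" if "x \<in> A" for x
      using MA[OF that] by simp
    show "\<not> p dvd M"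
      using pN M(2) by (metis dvd_minus_iff int_dvd_int_iff)
    show "- x \<in> A" if "x \<in> A" for x
      using A_diff[OF A_of_int[of 0] that] by simp
    show "0 \<in> A" "0 \<in> int_adjoin \<eta>"
      using A_of_int[of 0] int_adjoin_of_int[of 0] by simp_all
    show "finite R" unfolding R_def by simp
  qed (use A_add int_adjoin_add minus p in blast)+
qed

text \<open>The classical description of cubic rings by binary cubic forms: with \<open>\<omega> * \<theta>\<close> an integer, the
  index of \<open>x * \<omega> + y * \<theta>\<close> is the value of the form at \<open>(x, y)\<close>.\<close>

lemma index_form:
  obtains \<omega> \<theta> a b c d where "integral_basis \<omega> \<theta>" "\<omega> * \<theta> = of_int (- (a * d))"
    "\<omega>\<^sup>2 = of_int (- (a * c)) + of_int b * \<omega> - of_int a * \<theta>"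
    "\<theta>\<^sup>2 = of_int (- (b * d)) + of_int d * \<omega> - of_int c * \<theta>"
proof -
  obtain \<omega> \<theta> n where b: "integral_basis \<omega> \<theta>" and n: "\<omega> * \<theta> = of_int n"
    using integral_basis_normalized by blast
  then have A: "\<omega> \<in> A" "\<theta> \<in> A"
    and gen: "\<And>x. x \<in> A \<Longrightarrow> \<exists>k i j. x = of_int k + of_int i * \<omega> + of_int j * \<theta>"
    and ind: "\<And>k i j. of_int k + of_int i * \<omega> + of_int j * \<theta> = 0 \<Longrightarrow> k = 0 \<and> i = 0 \<and> j = 0"
    unfolding integral_basis_def by blast+
  obtain q b' a' where q: "\<omega>\<^sup>2 = of_int q + of_int b' * \<omega> + of_int a' * \<theta>"
    using gen[OF A_mult[OF A(1) A(1)]] unfolding power2_eq_square by blast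
  obtain l d c' where l: "\<theta>\<^sup>2 = of_int l + of_int d * \<omega> + of_int c' * \<theta>"
    using gen[OF A_mult[OF A(2) A(2)]] unfolding power2_eq_square by blast
  define N :: complex where "N = of_int n"
  have N: "\<omega> * \<theta> = N" unfolding N_def by (rule n)
  \<comment> \<open>Associativity is applied to \<omega> \<omega> \<theta> and then, with the roles
    exchanged, to \<theta> \<theta> \<omega>; comparing coordinates determines n, q and l.\<close>
  have 1: "of_int (b' * n + a' * l) + of_int (a' * d - n) * \<omega> + of_int (q + a' * c') * \<theta> = 0"
    using cubic_basis_assoc[OF N q l] unfolding of_int_add of_int_diff of_int_mult N_def .
  have "\<theta> * \<omega> = N" using N by (simp only: mult.commute)
  moreover have "\<theta>\<^sup>2 = of_int l + of_int c' * \<theta> + of_int d * \<omega>" using l by (simp only: add_ac)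
  moreover have "\<omega>\<^sup>2 = of_int q + of_int a' * \<theta> + of_int b' * \<omega>" using q by (simp only: add_ac)
  ultimately have "of_int (c' * n + d * q) + of_int (d * a' - n) * \<theta> + of_int (l + d * b') * \<omega> = 0"
    unfolding of_int_add of_int_diff of_int_mult N_def[symmetric] by (rule cubic_basis_assoc)
  then have 2: "of_int (c' * n + d * q) + of_int (l + d * b') * \<omega> + of_int (d * a' - n) * \<theta> = 0"
    by (simp only: add_ac)
  from ind[OF 1] ind[OF 2] have 1: "n = a' * d" "q = - (a' * c')" and 2: "l = - (b' * d)"
    by (simp_all add: mult.commute)
  show ?thesis
  \<comment> \<open>The sign changes of \<open>a'\<close> and \<open>c'\<close> produce the
    Delone-Faddeev multiplication table of the form with coefficients a, b, c, d.\<close>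
  proof (rule that[of \<omega> \<theta> "- a'" d "- c'" b'])
    show "integral_basis \<omega> \<theta>" by (rule b)
  qed (use n q l 1 2 in simp_all)
qed

text \<open>The prime 2 is treated through \<alpha>, because a form such as x^2 y + x y^2 takes only
  even values although its coefficients are odd.\<close>

lemma exists_index_not_dvd:
  assumes p: "Factorial_Ring.prime (p :: nat)"
  shows "\<exists>\<eta>\<in>primitive_integers K. \<not> p dvd element_index K \<eta>"
proof (cases "p = 2")
  case True
  have "of_int ((m\<^sup>2 + 3 * m + 9)\<^sup>2) * x \<in> int_adjoin \<alpha>" if x: "x \<in> A" for x
  proof -
    obtain x1 x2 where "conjs x x1 x2" using x K_iff[of x] unfolding A_iff by blast
    with x obtain U V W where
      eq: "of_int ((m\<^sup>2 + 3 * m + 9)\<^sup>2) * x = of_int U + of_int V * \<alpha> + of_int W * (\<alpha> * \<alpha>)"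
      using disc_mult_integer[of x x1 x2] unfolding A_iff power2_eq_square[of \<alpha>] by metis
    show ?thesis
      unfolding eq by (intro int_adjoin_add int_adjoin_mult int_adjoin_of_int int_adjoin_incl)
  qed
  moreover have "\<not> int p dvd (m\<^sup>2 + 3 * m + 9)\<^sup>2" using True by simp
  ultimately have "\<not> p dvd element_index K \<alpha>"
    by (intro element_index_not_dvd[OF p A_\<alpha>])
  moreover have "\<alpha> \<in> primitive_integers K"
    using A_\<alpha> \<alpha>_notin_Rats unfolding primitive_integers_iff A_iff by blast
  ultimately show ?thesis by blast
next
  case False
  obtain \<omega> \<theta> a b c d where basis: "integral_basis \<omega> \<theta>" and n: "\<omega> * \<theta> = of_int (- (a * d))"
    and w2: "\<omega>\<^sup>2 = of_int (- (a * c)) + of_int b * \<omega> - of_int a * \<theta>"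
    and t2: "\<theta>\<^sup>2 = of_int (- (b * d)) + of_int d * \<omega> - of_int c * \<theta>"
    by (rule index_form)
  from basis have A: "\<omega> \<in> A" "\<theta> \<in> A"
    and gen: "\<And>x. x \<in> A \<Longrightarrow> \<exists>k i j. x = of_int k + of_int i * \<omega> + of_int j * \<theta>"
    and ind: "\<And>k i j. of_int k + of_int i * \<omega> + of_int j * \<theta> = 0 \<Longrightarrow> k = 0 \<and> i = 0 \<and> j = 0"
    unfolding integral_basis_def by blast+
  show ?thesis
  proof (rule ccontr)
    assume contra: "\<not> ?thesis"
    have dvd: "int p dvd a * x ^ 3 + b * x\<^sup>2 * y + c * x * y\<^sup>2 + d * y ^ 3" (is "_ dvd ?f") for x y
    proof (rule ccontr)
      assume nd: "\<not> int p dvd ?f"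
      define \<eta> where "\<eta> = of_int x * \<omega> + of_int y * \<theta>"
      \<comment> \<open>The coordinate at 1 of \<eta>^2. Solving the expressions of \<eta> and
        \<eta>^2 - r for \<omega> and \<theta> by Cramer's rule has the value of the form as
        determinant, so this value annihilates the quotient by \<int>[\<eta>].\<close>
      define r where "r = - (x\<^sup>2 * a * c) - 2 * x * y * a * d - y\<^sup>2 * b * d"
      have \<eta>A: "\<eta> \<in> A" unfolding \<eta>_def by (intro A_add A_mult A A_of_int)
      have "of_int ?f * \<omega> = of_int y * (\<eta> * \<eta>) + of_int (a * x\<^sup>2 + c * y\<^sup>2) * \<eta> - of_int (y * r)"
        using n w2 t2 unfolding \<eta>_def r_def of_int_minus of_int_add of_int_diff of_int_mult of_int_power of_int_numeral
        by Groebner_Basis.algebra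
      also have "\<dots> \<in> int_adjoin \<eta>"
        by (intro int_adjoin_add int_adjoin_diff int_adjoin_mult int_adjoin_of_int int_adjoin_incl)
      finally have w: "of_int ?f * \<omega> \<in> int_adjoin \<eta>" .
      have "of_int ?f * \<theta> = of_int (b * x\<^sup>2 + d * y\<^sup>2) * \<eta> - of_int x * (\<eta> * \<eta>) + of_int (x * r)"
        using n w2 t2 unfolding \<eta>_def r_def of_int_minus of_int_add of_int_diff of_int_mult of_int_power of_int_numeral
        by Groebner_Basis.algebra
      also have "\<dots> \<in> int_adjoin \<eta>"
        by (intro int_adjoin_add int_adjoin_diff int_adjoin_mult int_adjoin_of_int int_adjoin_incl)
      finally have t: "of_int ?f * \<theta> \<in> int_adjoin \<eta>" .
      have "of_int ?f * z \<in> int_adjoin \<eta>" if zA: "z \<in> A" for z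
      proof -
        obtain k i j where z: "z = of_int k + of_int i * \<omega> + of_int j * \<theta>" using gen[OF zA] by blast
        have "of_int ?f * z = of_int ?f * of_int k + of_int i * (of_int ?f * \<omega>) + of_int j * (of_int ?f * \<theta>)"
          unfolding z by Groebner_Basis.algebra
        also have "\<dots> \<in> int_adjoin \<eta>"
          by (intro int_adjoin_add w t int_adjoin_mult[OF int_adjoin_of_int] int_adjoin_of_int)
        finally show ?thesis .
      qed
      then have "\<not> p dvd element_index K \<eta>"
        using nd by (rule element_index_not_dvd[OF p \<eta>A])
      moreover have "\<eta> \<notin> \<rat>"
      proof
        assume "\<eta> \<in> \<rat>"
        then obtain k where "\<eta> = of_int k" using A_Rats[OF \<eta>A] by blast
        \<comment> \<open>A rational \<eta> would force x = y = 0, where the form has the value 0, a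
          multiple of p.\<close>
        then have "of_int (- k) + of_int x * \<omega> + of_int y * \<theta> = 0"
          unfolding \<eta>_def of_int_minus by (simp only: add.assoc) simp
        from ind[OF this] nd show False by simp
      qed
      then have "\<eta> \<in> primitive_integers K"
        using \<eta>A unfolding primitive_integers_iff A_iff by blast
      ultimately show False using contra by blast
    qed
    have pp: "Factorial_Ring.prime (int p)" using p by simp
    have "\<not> int p dvd 2"
    proof
      assume "int p dvd 2"
      then have "p dvd 2" by (metis int_dvd_int_iff of_nat_numeral)
      with p False show False by (simp add: primes_dvd_imp_eq two_is_prime_nat)
    qed
    have ad: "int p dvd a" "int p dvd d" using dvd[of 1 0] dvd[of 0 1] by simp_all
    have bc: "int p dvd a + b + c + d" "int p dvd a - b + c - d" using dvd[of 1 1] dvd[of 1 "- 1"] by simp_all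
    have "2 * c = (a + b + c + d) + (a - b + c - d) - 2 * a" by simp
    \<comment> \<open>The values at (1, 1) and (1, - 1) isolate 2 c, and p is odd.\<close>
    then have "int p dvd 2 * c" using ad bc by (metis dvd_add dvd_diff dvd_mult)
    then have c: "int p dvd c" using pp \<open>\<not> int p dvd 2\<close> prime_dvd_mult_iff by blast
    have "b = (a + b + c + d) - a - c - d" by simp
    then have b: "int p dvd b" using ad bc c by (metis dvd_diff)
    obtain a' b' c' d' where eq: "a = int p * a'" "b = int p * b'" "c = int p * c'" "d = int p * d'"
      using ad b c unfolding dvd_def by blast
    define P where "P = (of_int (int p) :: complex)"
    have P0: "P \<noteq> 0" using p unfolding P_def by (simp add: prime_gt_0_nat)
    define z where "z = \<omega> / P"
    have \<omega>: "\<omega> = P * z" unfolding z_def using P0 by simp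
    \<comment> \<open>Since \<omega> is a root of t^3 - b t^2 + a c t - a^2 d, whose coefficients
      are divisible by p, p^2 and p^3, the quotient \<omega> / p satisfies a monic integer
      equation.\<close>
    have "P ^ 3 * (z ^ 3 - of_int b' * z\<^sup>2 + of_int (a' * c') * z - of_int (a'\<^sup>2 * d')) = 0"
      using n w2 unfolding \<omega> eq of_int_minus of_int_mult of_int_power P_def[symmetric] by Groebner_Basis.algebra
    then have "z ^ 3 - of_int b' * z\<^sup>2 + of_int (a' * c') * z - of_int (a'\<^sup>2 * d') = 0"
      using P0 by (metis mult_eq_0_iff power_eq_0_iff)
    moreover have "poly (map_poly of_int [:- (a'\<^sup>2 * d'), a' * c', - b', 1:]) z =
        z ^ 3 - of_int b' * z\<^sup>2 + of_int (a' * c') * z - of_int (a'\<^sup>2 * d')"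
      by (simp only: of_int_hom.map_poly_pCons_hom poly_pCons map_poly_0 poly_0 of_int_1 of_int_minus)
        Groebner_Basis.algebra
    ultimately have "algebraic_int z"
      unfolding algebraic_int_altdef_ipoly
      by (intro exI[of _ "[:- (a'\<^sup>2 * d'), a' * c', - b', 1:]"]) simp
    moreover have "z \<in> K"
      unfolding z_def field_class.field_divide_inverse P_def
      using A(1) by (intro rat_adjoin_mult rat_adjoin_inverse rat_adjoin_of_int) (simp add: A_iff)
    ultimately obtain k i j where z: "z = of_int k + of_int i * \<omega> + of_int j * \<theta>"
      using gen[of z] unfolding A_iff by blast
    \<comment> \<open>In the basis, p z = \<omega> would give the coordinate 1 at \<omega> as a
      multiple of p.\<close>
    have "of_int (int p * k) + of_int (int p * i - 1) * \<omega> + of_int (int p * j) * \<theta> = 0"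
      using \<omega> unfolding z of_int_diff of_int_mult P_def[symmetric] of_int_1 by Groebner_Basis.algebra
    from ind[OF this] have "int p * i = 1" by simp
    then have "int p dvd 1" by (metis dvd_triv_left)
    with pp show False by (simp add: not_prime_unit)
  qed
qed

lemma index_gcd_K: "index_gcd K = 1"
proof (rule ccontr)
  assume "index_gcd K \<noteq> 1"
  \<comment> \<open>This includes the value 0, which every prime divides.\<close>
  then obtain p where p: "Factorial_Ring.prime p" "p dvd index_gcd K"
    using prime_factor_nat by blast
  obtain \<eta> where \<eta>: "\<eta> \<in> primitive_integers K" "\<not> p dvd element_index K \<eta>"
    using exists_index_not_dvd[OF p(1)] by blast
  have "index_gcd K dvd element_index K \<eta>"
    unfolding index_gcd_def using \<eta>(1) by (intro Gcd_dvd imageI)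
  with p(2) \<eta>(2) show False using dvd_trans by blast
qed

end

section \<open>The residue classes modulo 243 and the conclusion\<close>

text \<open>The numbers 39, 39 + 81 and 39 + 162 are the three lifts of 39 mod 81 to residues mod
  243.\<close>

lemma simplest_cubic_residues:
  "[m = 39] (mod 243) \<or> [m = 120] (mod 243) \<or> [m = 201] (mod 243) \<longleftrightarrow> 81 dvd m - (39 :: int)"
  unfolding cong_iff_dvd_diff
proof
  assume "243 dvd m - 39 \<or> 243 dvd m - 120 \<or> 243 dvd m - 201"
  then obtain k where "m = 243 * k + 39 \<or> m = 243 * k + 120 \<or> m = 243 * k + 201"
    by (metis diff_eq_eq dvd_def)
  then have "m - 39 = 81 * (3 * k) \<or> m - 39 = 81 * (3 * k + 1) \<or> m - 39 = 81 * (3 * k + 2)"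
    by auto
  then show "81 dvd m - 39" by (metis dvd_triv_left)
next
  assume "81 dvd m - 39"
  then obtain k where k: "m - 39 = 81 * k" by (metis dvdE)
  define j where "j = k div 3"
  have "k = 3 * j \<or> k = 3 * j + 1 \<or> k = 3 * j + 2" unfolding j_def by presburger
  then have "m - 39 = 243 * j \<or> m - 120 = 243 * j \<or> m - 201 = 243 * j" using k by auto
  then show "243 dvd m - 39 \<or> 243 dvd m - 120 \<or> 243 dvd m - 201" by (metis dvd_triv_left)
qed

theorem theorem1p3:
  fixes m :: int and \<alpha> :: complex
  assumes "poly (map_poly of_int (simplest_cubic m)) \<alpha> = 0"
  shows "index_gcd (rat_adjoin \<alpha>) = 1 \<and>
    value_lcm (rat_adjoin \<alpha>) =
      (if [m = 39] (mod 243) \<or> [m = 120] (mod 243) \<or> [m = 201] (mod 243) then 3 else 1)"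
proof -
  have "poly (map_poly of_int (simplest_cubic m)) \<alpha> =
      \<alpha> ^ 3 - (of_int m * \<alpha>\<^sup>2 + (of_int m + 3) * \<alpha> + 1)"
    unfolding simplest_cubic_def
    by (simp only: of_int_hom.map_poly_pCons_hom poly_pCons map_poly_0 poly_0 of_int_minus
        of_int_add of_int_numeral of_int_1) Groebner_Basis.algebra
  with assms interpret simplest_cubic_root m \<alpha>
    by unfold_locales simp
  have "[m = 39] (mod 243) \<or> [m = 120] (mod 243) \<or> [m = 201] (mod 243) \<longleftrightarrow> 81 dvd m - 39"
    by (rule simplest_cubic_residues)
  then show ?thesis
    using index_gcd_K value_lcm_K by simp
qed

end
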